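(* Let $\psi:\mathbb{N}\to(0,1]$ be any function. Then \[ \frac{1}{1+\overline{\tau}_\psi}\leq \dim_H L(\psi)\leq \frac{1}{1+\underline{\tau}_\psi}, \] where $\underline{\tau}_\psi=\liminf_{q\to\infty}\frac{-\log\psi(q)}{\log q}$ and $\overline{\tau}_\psi=\limsup_{q\to\infty}\frac{-\log\psi(q)}{\log q}$, and $\dim_H$ denotes Hausdorff dimension.
   Context: Every $x\in(0,1]$ has a unique Lüroth expansion $x=\sum_{k=1}^\infty \frac{1}{d_k\prod_{j=1}^{k-1}d_j(d_j-1)}$ with digits $d_k=d_k(x)\in\{2,3,4,\dots\}$. For $n\in\mathbb{N}$ define $Q_n(x)=d_n\prod_{j=1}^{n-1}d_j(d_j-1)$ (empty product $=1$) and $P_n(x)=Q_n(x)\sum_{k=1}^n \frac{1}{d_k\prod_{j=1}^{k-1}d_j(d_j-1)}$. For $\psi:\mathbb{N}\to(0,1]$, \[ L(\psi)=\limsup_{n\to\infty}\Big\{x\in(0,1]: \Big|x-\frac{P_n(x)}{Q_n(x)}\Big|<\frac{\psi(Q_n(x))}{Q_n(x)}\Big\}, \] the set of $x$ for which the inequality holds for infinitely many $n$. Conventions: $1/(1+\infty)=0$. *)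

theory Defs
  imports "HOL-Analysis.Analysis"
begin

section \<open>Hausdorff dimension\<close>

text \<open>
  The value of \<open>0 powr 0\<close> is \<open>0\<close> in Isabelle, so the exponent \<open>s = 0\<close> is treated separately;
  this makes the \<open>0\<close>-dimensional Hausdorff measure the counting measure.
\<close>

definition hausdorff_gauge :: "real \<Rightarrow> 'a::metric_space set \<Rightarrow> ennreal" where
  "hausdorff_gauge s U =
     (if U = {} then 0 else if s = 0 then 1 else ennreal (diameter U powr s))"

text \<open>
  Boundedness of the covering sets is required explicitly, because \<open>diameter\<close> is real-valued
  and carries no information on unbounded sets.
\<close>

definition hausdorff_premeasure :: "real \<Rightarrow> real \<Rightarrow> 'a::metric_space set \<Rightarrow> ennreal" where
  "hausdorff_premeasure \<delta> s A =
     (INF U \<in> {U :: nat \<Rightarrow> 'a set.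
                 (\<forall>i. bounded (U i) \<and> diameter (U i) \<le> \<delta>) \<and> A \<subseteq> (\<Union>i. U i)}.
        \<Sum>i. hausdorff_gauge s (U i))"

definition hausdorff_measure :: "real \<Rightarrow> 'a::metric_space set \<Rightarrow> ennreal" where
  "hausdorff_measure s A = (SUP \<delta>\<in>{0<..}. hausdorff_premeasure \<delta> s A)"

definition hausdorff_dim :: "'a::metric_space set \<Rightarrow> ereal" where
  "hausdorff_dim A = (INF s\<in>{s. 0 \<le> s \<and> hausdorff_measure s A = 0}. ereal s)"


section \<open>Lueroth expansions\<close>

definition lueroth_denom :: "(nat \<Rightarrow> nat) \<Rightarrow> nat \<Rightarrow> nat" where
  "lueroth_denom d n = d n * (\<Prod>j=1..<n. d j * (d j - 1))"

text \<open>
  Digit sequences are indexed from \<open>1\<close>. The unused entry at index \<open>0\<close> is pinned to \<open>0\<close> so that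
  the sequence is unique as a function. All digits are at least \<open>2\<close>, so the natural-number
  subtraction in \<open>lueroth_denom\<close> never truncates.
\<close>

definition is_lueroth_expansion :: "(nat \<Rightarrow> nat) \<Rightarrow> real \<Rightarrow> bool" where
  "is_lueroth_expansion d x \<longleftrightarrow>
     d 0 = 0 \<and> (\<forall>k\<ge>1. 2 \<le> d k) \<and> (\<lambda>k. 1 / real (lueroth_denom d (Suc k))) sums x"

definition lueroth_digit :: "real \<Rightarrow> nat \<Rightarrow> nat" where
  "lueroth_digit x = (THE d. is_lueroth_expansion d x)"

lemma lueroth_denom_1 [simp]: "lueroth_denom d (Suc 0) = d (Suc 0)"
  by (simp add: lueroth_denom_def)

lemma lueroth_denom_shift:
  "lueroth_denom d (Suc (Suc k)) =
     d 1 * (d 1 - 1) * lueroth_denom (\<lambda>j. if j = 0 then 0 else d (Suc j)) (Suc k)"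
proof -
  have "(\<Prod>j=1..<Suc (Suc k). d j * (d j - 1)) =
        d 1 * (d 1 - 1) * (\<Prod>j=Suc 1..<Suc (Suc k). d j * (d j - 1))"
    by (subst prod.atLeast_Suc_lessThan) auto
  also have "(\<Prod>j=Suc 1..<Suc (Suc k). d j * (d j - 1)) = (\<Prod>j=1..<Suc k. d (Suc j) * (d (Suc j) - 1))"
    by (subst prod.shift_bounds_Suc_ivl) simp
  finally show ?thesis
    by (simp add: lueroth_denom_def)
qed

lemma lueroth_partial_sum_le:
  assumes "\<And>k. k \<ge> 1 \<Longrightarrow> 2 \<le> d k"
  shows "(\<Sum>k<n. 1 / real (lueroth_denom d (Suc k))) \<le> 1"
  using assms
proof (induction n arbitrary: d)
  case (Suc n)
  define e where "e = (\<lambda>j. if j = 0 then 0 else d (Suc j))"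
  have d: "2 \<le> d 1" using Suc.prems by simp
  have IH: "(\<Sum>k<n. 1 / real (lueroth_denom e (Suc k))) \<le> 1"
    by (rule Suc.IH) (auto simp: e_def Suc.prems)
  have "(\<Sum>k<Suc n. 1 / real (lueroth_denom d (Suc k))) =
        1 / real (d 1) + (\<Sum>k<n. 1 / real (lueroth_denom d (Suc (Suc k))))"
    by (subst sum.lessThan_Suc_shift) simp
  also have "\<dots> = 1 / real (d 1) +
      (\<Sum>k<n. 1 / real (lueroth_denom e (Suc k))) / real (d 1 * (d 1 - 1))"
    by (simp add: lueroth_denom_shift sum_divide_distrib mult_ac flip: e_def)
  also have "\<dots> \<le> 1 / real (d 1) + 1 / real (d 1 * (d 1 - 1))"
    using IH by (intro add_left_mono divide_right_mono) auto
  also have "\<dots> = 1 / (real (d 1) - 1)"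
    using d by (simp add: of_nat_diff field_simps)
  also have "\<dots> \<le> 1" using d by simp
  finally show ?case .
qed simp

lemma lueroth_expansion_pos_le:
  assumes "is_lueroth_expansion d x"
  shows "0 < x" "x \<le> 1"
proof -
  have d: "\<And>k. k \<ge> 1 \<Longrightarrow> 2 \<le> d k" and s: "(\<lambda>k. 1 / real (lueroth_denom d (Suc k))) sums x"
    using assms by (auto simp: is_lueroth_expansion_def)
  have pos: "0 < 1 / real (lueroth_denom d (Suc k))" for k
  proof -
    have "0 < d j * (d j - 1)" if "j \<ge> 1" for j using d[OF that] by simp
    then show ?thesis using d[of "Suc k"] by (auto simp: lueroth_denom_def intro!: prod_pos)
  qed
  show "0 < x" using s pos suminf_pos[of "\<lambda>k. 1 / real (lueroth_denom d (Suc k))"]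
    by (auto simp: sums_iff)
  show "x \<le> 1"
    using s lueroth_partial_sum_le[OF d] unfolding sums_def
    by (intro LIMSEQ_le_const2) auto
qed

lemma lueroth_expansion_step:
  assumes "is_lueroth_expansion d x"
  defines "e \<equiv> (\<lambda>j. if j = 0 then 0 else d (Suc j))"
  shows "is_lueroth_expansion e (real (d 1) * (real (d 1) - 1) * x - (real (d 1) - 1))"
    and "int (d 1) = \<lfloor>1 / x\<rfloor> + 1"
proof -
  define y where "y = real (d 1) * (real (d 1) - 1) * x - (real (d 1) - 1)"
  have d: "\<And>k. k \<ge> 1 \<Longrightarrow> 2 \<le> d k" and s: "(\<lambda>k. 1 / real (lueroth_denom d (Suc k))) sums x"
    using assms by (auto simp: is_lueroth_expansion_def)
  have d1: "2 \<le> d 1" using d by simp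
  have "(\<lambda>k. 1 / real (lueroth_denom d (Suc (Suc k)))) sums (x - 1 / real (d 1))"
    using s by (subst sums_Suc_iff) simp
  then have "(\<lambda>k. real (d 1) * (real (d 1) - 1) * (1 / real (lueroth_denom d (Suc (Suc k)))))
      sums (real (d 1) * (real (d 1) - 1) * (x - 1 / real (d 1)))"
    by (rule sums_mult)
  also have "(\<lambda>k. real (d 1) * (real (d 1) - 1) * (1 / real (lueroth_denom d (Suc (Suc k))))) =
      (\<lambda>k. 1 / real (lueroth_denom e (Suc k)))"
    using d1 by (simp add: lueroth_denom_shift e_def of_nat_diff)
  also have "real (d 1) * (real (d 1) - 1) * (x - 1 / real (d 1)) = y"
    using d1 by (simp add: y_def field_simps)
  finally show e: "is_lueroth_expansion e y"
    unfolding is_lueroth_expansion_def by (auto simp: e_def d)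
  have "0 < y" "y \<le> 1" "0 < x"
    using lueroth_expansion_pos_le[OF e] lueroth_expansion_pos_le[OF assms(1)] by auto
  have D: "real (d 1) - 1 > 0" using d1 by simp
  have "0 < (real (d 1) - 1) * (real (d 1) * x - 1)"
    using \<open>0 < y\<close> by (simp add: y_def algebra_simps)
  then have 1: "1 < real (d 1) * x" using D by (simp add: zero_less_mult_iff)
  have "real (d 1) * ((real (d 1) - 1) * x) \<le> real (d 1) * 1"
    using \<open>y \<le> 1\<close> by (simp add: y_def algebra_simps)
  then have 2: "(real (d 1) - 1) * x \<le> 1" using d1 by (subst (asm) mult_le_cancel_left_pos) auto
  have "\<lfloor>1 / x\<rfloor> = int (d 1) - 1"
    using 1 2 \<open>0 < x\<close> by (intro floor_unique) (auto simp: field_simps)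
  then show "int (d 1) = \<lfloor>1 / x\<rfloor> + 1" by simp
qed

lemma lueroth_expansion_unique:
  assumes "is_lueroth_expansion d x" "is_lueroth_expansion e x"
  shows "d = e"
proof -
  have "d (Suc n) = e (Suc n)"
    if "is_lueroth_expansion d x" "is_lueroth_expansion e x" for d e x n
    using that
  proof (induction n arbitrary: d e x)
    case 0
    then show ?case
      using lueroth_expansion_step(2)[OF 0(1)] lueroth_expansion_step(2)[OF 0(2)] by simp
  next
    case (Suc n)
    have eq: "d 1 = e 1"
      using lueroth_expansion_step(2)[OF Suc.prems(1)] lueroth_expansion_step(2)[OF Suc.prems(2)]
      by simp
    show ?case
      using Suc.IH[OF lueroth_expansion_step(1)[OF Suc.prems(1)]
          lueroth_expansion_step(1)[OF Suc.prems(2), folded eq]]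
      by simp
  qed
  moreover have "d 0 = e 0" using assms by (simp add: is_lueroth_expansion_def)
  ultimately show ?thesis using assms by (metis ext not0_implies_Suc)
qed

lemma lueroth_expansion_exists:
  assumes "0 < x" "x \<le> 1"
  shows "\<exists>d. is_lueroth_expansion d x"
proof -
  define c :: "real \<Rightarrow> nat" where "c = (\<lambda>x. nat (\<lfloor>1 / x\<rfloor> + 1))"
  define T :: "real \<Rightarrow> real" where "T = (\<lambda>x. real (c x) * (real (c x) - 1) * x - (real (c x) - 1))"
  define t where "t = (\<lambda>n. (T ^^ n) x)"
  define d where "d = (\<lambda>k. if k = 0 then 0 else c (t (k - 1)))"
  have step: "2 \<le> c y \<and> 0 < T y \<and> T y \<le> 1" if y: "0 < y" "y \<le> 1" for y
  proof -
    have f: "1 \<le> \<lfloor>1 / y\<rfloor>" using y by simp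
    then have c: "real (c y) = of_int \<lfloor>1 / y\<rfloor> + 1" unfolding c_def by linarith
    have c2: "2 \<le> c y" using f unfolding c_def by linarith
    have "1 / y < real (c y)" "real (c y) - 1 \<le> 1 / y" unfolding c by linarith+
    then have a: "0 < real (c y) * y - 1" and b: "(real (c y) - 1) * y \<le> 1"
      using y by (auto simp: field_simps)
    have "0 < (real (c y) - 1) * (real (c y) * y - 1)" using a c2 by (intro mult_pos_pos) auto
    moreover have "real (c y) * ((real (c y) - 1) * y) \<le> real (c y) * 1"
      using b by (intro mult_left_mono) auto
    ultimately show ?thesis using c2 by (auto simp: T_def algebra_simps)
  qed
  have t: "0 < t n \<and> t n \<le> 1" for n
    by (induction n) (use assms step in \<open>auto simp: t_def\<close>)
  have d2: "2 \<le> d (Suc n)" for n using step t[of n] by (simp add: d_def)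
  define p where "p = (\<lambda>n. \<Prod>j=1..<Suc n. real (d j) * (real (d j) - 1))"
  have psuc: "p (Suc n) = p n * (real (d (Suc n)) * (real (d (Suc n)) - 1))" for n
    by (simp add: p_def)
  have p: "2 ^ n \<le> p n" for n
  proof (induction n)
    case (Suc n)
    have "(2::real) * 1 \<le> real (d (Suc n)) * (real (d (Suc n)) - 1)"
      using d2[of n] by (intro mult_mono) auto
    then have "2 ^ n * 2 \<le> p n * (real (d (Suc n)) * (real (d (Suc n)) - 1))"
      using Suc by (intro mult_mono) (auto intro: order_trans[OF _ Suc])
    then show ?case by (simp add: psuc)
  qed (simp add: p_def)
  have den: "real (lueroth_denom d (Suc n)) = real (d (Suc n)) * p n" for n
  proof -
    have "(\<Prod>j=1..<Suc n. real (d j * (d j - 1))) = p n"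
      unfolding p_def
    proof (rule prod.cong)
      fix j assume "j \<in> {1..<Suc n}"
      then have "2 \<le> d j" using d2[of "j - 1"] by simp
      then show "real (d j * (d j - 1)) = real (d j) * (real (d j) - 1)" by (simp add: of_nat_diff)
    qed simp
    then show ?thesis unfolding lueroth_denom_def of_nat_mult[of "d (Suc n)"] of_nat_prod by simp
  qed
  have tS: "t (Suc n) = real (d (Suc n)) * (real (d (Suc n)) - 1) * t n - (real (d (Suc n)) - 1)" for n
    by (simp add: t_def d_def T_def)
  have part: "(\<Sum>k<n. 1 / real (lueroth_denom d (Suc k))) = x - t n / p n" for n
  proof (induction n)
    case 0
    then show ?case by (simp add: t_def p_def)
  next
    case (Suc n)
    have "0 < p n" using p[of n] by (rule less_le_trans[rotated]) simp
    moreover have "0 < real (d (Suc n))" "0 < real (d (Suc n)) - 1" using d2[of n] by auto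
    ultimately have "1 / (real (d (Suc n)) * p n) - t n / p n = - t (Suc n) / p (Suc n)"
      unfolding psuc tS by (simp add: divide_simps) (simp add: algebra_simps)
    then show ?case using Suc by (simp add: den)
  qed
  have "(\<lambda>n. t n / p n) \<longlonglongrightarrow> 0"
  proof (rule tendsto_sandwich[of "\<lambda>_. 0" _ _ "\<lambda>n. (1/2) ^ n"])
    have pp: "0 < p n" for n using p[of n] by (rule less_le_trans[rotated]) simp
    show "\<forall>\<^sub>F n in sequentially. 0 \<le> t n / p n" using t pp by (auto intro!: always_eventually simp: less_imp_le)
    have "t n / p n \<le> (1/2) ^ n" for n
      using t[of n] p[of n] pp[of n] frac_le[of 1 "t n" "2 ^ n" "p n"] by (simp add: power_divide)
    then show "\<forall>\<^sub>F n in sequentially. t n / p n \<le> (1/2) ^ n" by auto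
    show "(\<lambda>n. (1/2::real) ^ n) \<longlonglongrightarrow> 0" by (rule LIMSEQ_power_zero) simp
  qed simp
  then have "(\<lambda>k. 1 / real (lueroth_denom d (Suc k))) sums x"
    unfolding sums_def part using tendsto_diff[OF tendsto_const[of x]] by fastforce
  moreover have "\<forall>k\<ge>1. 2 \<le> d k" using d2 by (metis Suc_le_D One_nat_def)
  ultimately show ?thesis unfolding is_lueroth_expansion_def by (intro exI[of _ d]) (simp add: d_def)
qed

theorem lueroth_expansion_ex1:
  "0 < x \<Longrightarrow> x \<le> 1 \<Longrightarrow> \<exists>!d. is_lueroth_expansion d x"
  using lueroth_expansion_exists lueroth_expansion_unique by blast


section \<open>Approximation by Lueroth convergents\<close>

definition lueroth_Q :: "nat \<Rightarrow> real \<Rightarrow> nat" where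
  "lueroth_Q n x = lueroth_denom (lueroth_digit x) n"

definition lueroth_P :: "nat \<Rightarrow> real \<Rightarrow> real" where
  "lueroth_P n x =
     real (lueroth_Q n x) * (\<Sum>k=1..n. 1 / real (lueroth_denom (lueroth_digit x) k))"

definition lueroth_limsup_set :: "(nat \<Rightarrow> real) \<Rightarrow> real set" where
  "lueroth_limsup_set \<psi> =
     {x \<in> {0<..1}. \<exists>\<^sub>F n in sequentially.
        \<bar>x - lueroth_P n x / real (lueroth_Q n x)\<bar> < \<psi> (lueroth_Q n x) / real (lueroth_Q n x)}"

definition lower_order :: "(nat \<Rightarrow> real) \<Rightarrow> ereal" where
  "lower_order \<psi> = liminf (\<lambda>q. ereal (- ln (\<psi> q) / ln (real q)))"

definition upper_order :: "(nat \<Rightarrow> real) \<Rightarrow> ereal" where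
  "upper_order \<psi> = limsup (\<lambda>q. ereal (- ln (\<psi> q) / ln (real q)))"

end

theory Submission
  imports Defs "HOL-Library.Nat_Bijection"
begin

text \<open>
  Upper bound: the intervals \<open>P\<^sub>n/Q\<^sub>n + [0, \<psi>(Q\<^sub>n)/Q\<^sub>n)\<close> over all digit words cover the set infinitely
  often, and \<open>\<Sum> Q\<^sub>n powr -(1 + \<epsilon>)\<close> over all words is finite because
  \<open>\<Sum>\<^sub>d (d (d - 1)) powr -(1 + \<epsilon>) < \<Sum>\<^sub>d 1 / (d (d - 1)) = 1\<close>.

  Lower bound: a map from \<open>(0,1]\<close> into the set copies the Lueroth digits of a point, except that
  at sparse stages, once \<open>Q\<^sub>n\<close> is large compared with all earlier exceptional stages, the remaining
  tail is first contracted into \<open>(0, 1/m]\<close> with \<open>m\<close> just above \<open>Q\<^sub>n powr t\<close>. This forces the next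
  digit beyond \<open>m\<close> and hence the required approximation. For
  \<open>s < 1 / (1 + t)\<close> the stages can be chosen so sparse that the inverse of this map is
  \<open>s\<close>-Hoelder, so by subadditivity of Lebesgue measure the image has positive \<open>s\<close>-dimensional
  Hausdorff measure.
\<close>

section \<open>Hausdorff measures of limsup sets and of expanding images\<close>

text \<open>The convergence half of a Borel-Cantelli argument: every tail of \<open>U\<close> covers
  \<open>A\<close>, and the tails of a convergent series are arbitrarily small.\<close>

lemma hausdorff_measure_limsup_eq_0:
  fixes U :: "nat \<Rightarrow> 'a::metric_space set"
  assumes s: "0 < s" and bdd: "\<And>i. bounded (U i)"
    and summ: "summable (\<lambda>i. diameter (U i) powr s)"
    and A: "\<And>x. x \<in> A \<Longrightarrow> \<exists>\<^sub>F i in sequentially. x \<in> U i"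
  shows "hausdorff_measure s A = 0"
proof -
  have "hausdorff_premeasure \<delta> s A \<le> ennreal e" if "0 < \<delta>" "0 < e" for \<delta> e :: real
  proof -
    have "eventually (\<lambda>i. diameter (U i) powr s < \<delta> powr s) sequentially"
      using summable_LIMSEQ_zero[OF summ] \<open>0 < \<delta>\<close> by (intro order_tendstoD(2)) auto
    then obtain M where M: "diameter (U i) powr s < \<delta> powr s" if "M \<le> i" for i
      by (auto simp: eventually_sequentially)
    have diam: "diameter (U i) \<le> \<delta>" if "M \<le> i" for i
      using M[OF that] powr_mono2[of s \<delta> "diameter (U i)"] s \<open>0 < \<delta>\<close> by (cases "diameter (U i) \<le> \<delta>") auto
    obtain N where N: "\<And>n. N \<le> n \<Longrightarrow> norm (\<Sum>i. diameter (U (i + n)) powr s) < e"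
      using suminf_exist_split[OF \<open>0 < e\<close> summ] by blast
    define V where "V = (\<lambda>i. U (i + max M N))"
    have "A \<subseteq> (\<Union>i. V i)"
    proof
      fix x assume "x \<in> A"
      then obtain i where "max M N \<le> i" "x \<in> U i"
        using A[OF \<open>x \<in> A\<close>] unfolding frequently_sequentially by blast
      then have "x \<in> V (i - max M N)" by (simp add: V_def)
      then show "x \<in> (\<Union>i. V i)" by blast
    qed
    then have "hausdorff_premeasure \<delta> s A \<le> (\<Sum>i. hausdorff_gauge s (V i))"
      unfolding hausdorff_premeasure_def
      by (intro INF_lower) (auto simp: V_def bdd diam)
    also have "\<dots> \<le> (\<Sum>i. ennreal (diameter (V i) powr s))"
      using s by (intro suminf_le) (auto simp: hausdorff_gauge_def)
    also have "\<dots> = ennreal (\<Sum>i. diameter (V i) powr s)"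
      unfolding V_def by (intro suminf_ennreal2 summable_ignore_initial_segment summ) auto
    also have "\<dots> \<le> ennreal e"
      using N[of "max M N"] by (intro ennreal_leI) (simp add: V_def)
    finally show ?thesis .
  qed
  then have "hausdorff_premeasure \<delta> s A = 0" if "0 < \<delta>" for \<delta>
    using ennreal_le_epsilon[of 0 "hausdorff_premeasure \<delta> s A"] that by simp
  then show ?thesis
    unfolding hausdorff_measure_def by simp
qed

text \<open>A cover of a nonempty set has a nonempty member, and that member has gauge
  \<open>1\<close>. This serves the exponent \<open>0\<close> in the lower bound.\<close>

lemma hausdorff_measure_0_eq_0D:
  assumes "hausdorff_measure 0 A = 0"
  shows "A = {}"
proof (rule ccontr)
  assume "A \<noteq> {}"
  have "1 \<le> hausdorff_premeasure 1 0 A"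
    unfolding hausdorff_premeasure_def
  proof (rule INF_greatest, clarify)
    fix U :: "nat \<Rightarrow> 'a set" assume "A \<subseteq> (\<Union>i. U i)"
    with \<open>A \<noteq> {}\<close> obtain i where "U i \<noteq> {}" by blast
    then have "1 = (\<Sum>j\<in>{i}. hausdorff_gauge 0 (U j))" by (simp add: hausdorff_gauge_def)
    also have "\<dots> \<le> (\<Sum>j. hausdorff_gauge 0 (U j))" by (intro sum_le_suminf) auto
    finally show "1 \<le> (\<Sum>j. hausdorff_gauge 0 (U j))" .
  qed
  also have "\<dots> \<le> hausdorff_measure 0 A"
    unfolding hausdorff_measure_def by (intro SUP_upper) auto
  finally show False using assms by simp
qed

text \<open>If the sets \<open>U i\<close> cover \<open>S\<close>, their preimages under
  \<open>f\<close> cover \<open>(0,1]\<close>, and each preimage lies in an interval of length at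
  most \<open>C * diameter (U i) powr s\<close>. So the gauges of a cover add up to at least
  \<open>1 / C\<close>.\<close>

lemma hausdorff_measure_pos_of_expanding:
  fixes f :: "real \<Rightarrow> 'a::metric_space"
  assumes s: "0 < s" and C: "0 < C" and f: "f ` {0<..1} \<subseteq> S"
    and exp: "\<And>x y. x \<in> {0<..1} \<Longrightarrow> y \<in> {0<..1} \<Longrightarrow> \<bar>x - y\<bar> \<le> C * dist (f x) (f y) powr s"
  shows "hausdorff_measure s S \<noteq> 0"
proof -
  have "ennreal (1 / C) \<le> hausdorff_premeasure 1 s S"
    unfolding hausdorff_premeasure_def
  proof (rule INF_greatest, clarify)
    fix U :: "nat \<Rightarrow> 'a set"
    assume bdd: "\<forall>i. bounded (U i) \<and> diameter (U i) \<le> 1" and cov: "S \<subseteq> (\<Union>i. U i)"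
    define B where "B = (\<lambda>i. {x \<in> {0<..1}. f x \<in> U i})"
    \<comment> \<open>Nothing is assumed about the measurability of \<open>f\<close>, so
      \<open>B i\<close> is enlarged to a closed interval.\<close>
    have "\<exists>K\<in>sets lborel. B i \<subseteq> K \<and> emeasure lborel K \<le> ennreal C * hausdorff_gauge s (U i)" for i
    proof (cases "B i = {}")
      case True
      then show ?thesis by (intro bexI[of _ "{}"]) auto
    next
      case False
      define r where "r = C * diameter (U i) powr s"
      have r: "\<bar>x - y\<bar> \<le> r" if "x \<in> B i" "y \<in> B i" for x y
      proof -
        have "\<bar>x - y\<bar> \<le> C * dist (f x) (f y) powr s"
          using that by (intro exp) (auto simp: B_def)
        also have "\<dots> \<le> r"
          unfolding r_def using that C s bdd
          by (intro mult_left_mono powr_mono2 diameter_bounded_bound) (auto simp: B_def)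
        finally show ?thesis .
      qed
      have "bdd_below (B i)" by (rule bdd_belowI[of _ 0]) (auto simp: B_def)
      then have "B i \<subseteq> {Inf (B i)..Inf (B i) + r}"
      proof (intro subsetI)
        fix x assume x: "x \<in> B i"
        have "x - r \<le> Inf (B i)"
          using False r[OF x] by (intro cInf_greatest) (auto simp: abs_le_iff algebra_simps)
        then show "x \<in> {Inf (B i)..Inf (B i) + r}"
          using cInf_lower[OF x \<open>bdd_below (B i)\<close>] by auto
      qed
      moreover have "0 \<le> r" using C by (simp add: r_def)
      moreover have "U i \<noteq> {}" using False by (auto simp: B_def)
      ultimately show ?thesis
        using s C by (intro bexI[of _ "{Inf (B i)..Inf (B i) + r}"])
          (auto simp: hausdorff_gauge_def r_def ennreal_mult)
    qed
    then obtain K where K: "\<And>i. K i \<in> sets lborel" "\<And>i. B i \<subseteq> K i"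
      "\<And>i. emeasure lborel (K i) \<le> ennreal C * hausdorff_gauge s (U i)"
      by metis
    have "{0<..1} \<subseteq> (\<Union>i. B i)" using f cov by (fastforce simp: B_def)
    then have sub: "{0<..1::real} \<subseteq> (\<Union>i. K i)" using K(2) by blast
    have "1 = emeasure lborel {0<..1::real}" by simp
    also have "\<dots> \<le> emeasure lborel (\<Union>i. K i)"
      using sub K(1) by (intro emeasure_mono) auto
    also have "\<dots> \<le> (\<Sum>i. emeasure lborel (K i))"
      using K(1) by (intro emeasure_subadditive_countably) auto
    also have "\<dots> \<le> (\<Sum>i. ennreal C * hausdorff_gauge s (U i))"
      using K(3) by (intro suminf_le) auto
    finally have "1 \<le> ennreal C * (\<Sum>i. hausdorff_gauge s (U i))" by simp
    then have "ennreal (1 / C) * 1 \<le> ennreal (1 / C) * (ennreal C * (\<Sum>i. hausdorff_gauge s (U i)))"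
      by (rule mult_left_mono) simp
    also have "\<dots> = (\<Sum>i. hausdorff_gauge s (U i))"
      using C by (simp add: mult.assoc[symmetric] ennreal_mult[symmetric])
    finally show "ennreal (1 / C) \<le> (\<Sum>i. hausdorff_gauge s (U i))" by simp
  qed
  also have "\<dots> \<le> hausdorff_measure s S"
    unfolding hausdorff_measure_def by (intro SUP_upper) auto
  finally show ?thesis using C by auto
qed

section \<open>The upper bound\<close>

lemma lueroth_digit_eq:
  assumes "is_lueroth_expansion d x"
  shows "lueroth_digit x = d"
  unfolding lueroth_digit_def
  using assms lueroth_expansion_unique by (intro the_equality) auto

lemma is_lueroth_expansion_digit:
  assumes "x \<in> {0<..1}"
  shows "is_lueroth_expansion (lueroth_digit x) x"
  using assms lueroth_expansion_exists[of x] lueroth_digit_eq by auto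

lemma lueroth_digit_ge_2:
  assumes "x \<in> {0<..1}" "1 \<le> k"
  shows "2 \<le> lueroth_digit x k"
  using is_lueroth_expansion_digit[OF assms(1)] assms(2) by (simp add: is_lueroth_expansion_def)

lemma lueroth_denom_ge_power:
  assumes "\<And>k. 1 \<le> k \<Longrightarrow> 2 \<le> d k"
  shows "2 ^ Suc n \<le> lueroth_denom d (Suc n)"
proof -
  have "2 \<le> d j * (d j - 1)" if "1 \<le> j" for j
    using mult_le_mono[of 2 "d j" 1 "d j - 1"] assms[OF that] by simp
  then have "(\<Prod>j=1..<Suc n. 2) \<le> (\<Prod>j=1..<Suc n. d j * (d j - 1))"
    by (intro prod_mono) auto
  then have "2 ^ n \<le> (\<Prod>j=1..<Suc n. d j * (d j - 1))" by simp
  then show ?thesis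
    unfolding lueroth_denom_def power_Suc using assms[of "Suc n"] by (intro mult_le_mono) auto
qed

lemma filterlim_lueroth_Q:
  assumes "x \<in> {0<..1}"
  shows "filterlim (\<lambda>n. lueroth_Q n x) at_top sequentially"
proof (rule filterlim_at_top_mono)
  show "filterlim (\<lambda>n::nat. n) at_top sequentially" by (rule filterlim_ident)
  have "n \<le> lueroth_Q n x" if "1 \<le> n" for n
  proof -
    from that obtain m where "n = Suc m" by (cases n) auto
    then have "2 ^ n \<le> lueroth_Q n x"
      unfolding lueroth_Q_def using lueroth_denom_ge_power lueroth_digit_ge_2[OF assms] by blast
    then show ?thesis using less_exp[of n] by linarith
  qed
  then show "\<forall>\<^sub>F n in sequentially. n \<le> lueroth_Q n x"
    unfolding eventually_sequentially by blast
qed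

text \<open>Words list the digits in reverse order, so that the head is the digit with the special
  role in \<open>Q\<^sub>n = d\<^sub>n \<Prod>\<^sub>j\<^sub><\<^sub>n d\<^sub>j (d\<^sub>j - 1)\<close>.\<close>

definition word_Q :: "nat list \<Rightarrow> nat" where
  "word_Q w = hd w * (\<Prod>d\<leftarrow>tl w. d * (d - 1))"

definition digit_word :: "nat \<Rightarrow> real \<Rightarrow> nat list" where
  "digit_word n x = rev (map (lueroth_digit x) [1..<Suc n])"

lemma length_digit_word [simp]: "length (digit_word n x) = n"
  by (simp add: digit_word_def)

lemma word_Q_digit_word: "word_Q (digit_word (Suc n) x) = lueroth_Q (Suc n) x"
proof -
  have "(\<Prod>d\<leftarrow>rev (map (lueroth_digit x) [1..<Suc n]). d * (d - 1)) =
      (\<Prod>j\<leftarrow>[1..<Suc n]. lueroth_digit x j * (lueroth_digit x j - 1))"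
    by (simp only: rev_map[symmetric] map_map o_def prod_list.rev)
  also have "\<dots> = (\<Prod>j=1..<Suc n. lueroth_digit x j * (lueroth_digit x j - 1))"
    by (subst prod.distinct_set_conv_list[symmetric]) (auto simp del: upt_Suc)
  finally show ?thesis
    by (simp add: word_Q_def digit_word_def lueroth_Q_def lueroth_denom_def)
qed

text \<open>Points sharing a word are compared with one common centre; this is what bounds the
  diameters in the cover below.\<close>

lemma convergent_eq_if_digit_word_eq:
  assumes "digit_word n x = digit_word n y"
  shows "lueroth_P n x / real (lueroth_Q n x) = lueroth_P n y / real (lueroth_Q n y)"
proof (cases n)
  case (Suc m)
  have eq: "lueroth_digit x j = lueroth_digit y j" if "j \<in> {1..n}" for j
    using assms that by (auto simp: digit_word_def simp del: upt_Suc)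
  have "lueroth_denom (lueroth_digit x) k = lueroth_denom (lueroth_digit y) k" if "k \<in> {1..n}" for k
  proof -
    have "(\<Prod>j=1..<k. lueroth_digit x j * (lueroth_digit x j - 1)) =
        (\<Prod>j=1..<k. lueroth_digit y j * (lueroth_digit y j - 1))"
      using that eq by (intro prod.cong) auto
    then show ?thesis
      unfolding lueroth_denom_def using eq[OF that] by simp
  qed
  then show ?thesis
    unfolding lueroth_P_def lueroth_Q_def using Suc by (auto intro!: sum.cong)
qed (simp add: lueroth_P_def)

section \<open>Summability of negative powers of \<open>word_Q\<close> over all digit words\<close>

lemma sum_prod_list_lists:
  fixes f :: "'a \<Rightarrow> 'b::comm_semiring_1"
  assumes "finite A"
  shows "(\<Sum>w | set w \<subseteq> A \<and> length w = n. \<Prod>d\<leftarrow>w. f d) = sum f A ^ n"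
proof (induction n)
  case 0
  have "{w. set w \<subseteq> A \<and> length w = 0} = {[]}" by auto
  then show ?case by simp
next
  case (Suc n)
  have "inj_on (\<lambda>(xs, n). n # xs) ({xs. set xs \<subseteq> A \<and> length xs = n} \<times> A)"
    by (auto intro!: inj_onI)
  then have "(\<Sum>w | set w \<subseteq> A \<and> length w = Suc n. \<Prod>d\<leftarrow>w. f d) =
      (\<Sum>(w, a)\<in>{w. set w \<subseteq> A \<and> length w = n} \<times> A. (\<Prod>d\<leftarrow>w. f d) * f a)"
    unfolding lists_length_Suc_eq by (subst sum.reindex) (auto simp: case_prod_unfold mult_ac)
  also have "\<dots> = (\<Sum>w | set w \<subseteq> A \<and> length w = n. \<Prod>d\<leftarrow>w. f d) * sum f A"
    by (simp add: sum.cartesian_product[symmetric] sum_product)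
  finally show ?case by (simp add: Suc mult_ac)
qed

text \<open>Split off one power: the sum of \<open>1 / (d (d - 1))\<close> telescopes to at most
  \<open>1\<close>, and the remaining \<open>(d (d - 1)) powr (1 - a)\<close> is at most
  \<open>2 powr (1 - a)\<close> since \<open>d (d - 1) \<ge> 2\<close>. For \<open>a > 1\<close> the
  bound is below \<open>1\<close> and becomes the ratio of a geometric series.\<close>

lemma sum_pronic_powr_le:
  fixes a :: real
  assumes "1 \<le> a"
  shows "(\<Sum>d\<in>{2..M}. real (d * (d - 1)) powr -a) \<le> 2 powr (1 - a)"
proof -
  have tele: "(\<Sum>d\<in>{2..M}. 1 / real (d * (d - 1))) \<le> 1"
  proof -
    have "(\<Sum>d\<in>{2..Suc m}. 1 / real (d * (d - 1))) = 1 - 1 / real (Suc m)" for m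
    proof (induction m)
      case (Suc m)
      have "(\<Sum>d\<in>{2..Suc (Suc m)}. 1 / real (d * (d - 1))) =
          (\<Sum>d\<in>{2..Suc m}. 1 / real (d * (d - 1))) + 1 / (real (Suc (Suc m)) * real (Suc m))"
        by simp
      also have "\<dots> = 1 - 1 / real (Suc (Suc m))"
        unfolding Suc by (simp add: divide_simps) (simp add: algebra_simps)
      finally show ?case .
    qed simp
    from this[of "M - 1"] show ?thesis by (cases M) auto
  qed
  have "real (d * (d - 1)) powr -a \<le> 2 powr (1 - a) * (1 / real (d * (d - 1)))" if "2 \<le> d" for d
  proof -
    have "2 \<le> d * (d - 1)" using mult_le_mono[of 2 d 1 "d - 1"] that by simp
    then have two: "2 \<le> real (d * (d - 1))" by linarith
    have "real (d * (d - 1)) powr -a = real (d * (d - 1)) powr (1 - a) * real (d * (d - 1)) powr -1"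
      unfolding powr_add[symmetric] by simp
    also have "\<dots> \<le> 2 powr (1 - a) * real (d * (d - 1)) powr -1"
      using two assms by (intro mult_right_mono powr_mono2') (auto simp del: of_nat_mult)
    also have "real (d * (d - 1)) powr -1 = 1 / real (d * (d - 1))"
      using two by (subst powr_minus_divide) simp
    finally show ?thesis .
  qed
  then have "(\<Sum>d\<in>{2..M}. real (d * (d - 1)) powr -a)
      \<le> (\<Sum>d\<in>{2..M}. 2 powr (1 - a) * (1 / real (d * (d - 1))))"
    by (intro sum_mono) auto
  also have "\<dots> = 2 powr (1 - a) * (\<Sum>d\<in>{2..M}. 1 / real (d * (d - 1)))"
    by (simp only: sum_distrib_left)
  also have "\<dots> \<le> 2 powr (1 - a) * 1" using tele by (intro mult_left_mono) auto
  finally show ?thesis by simp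
qed

definition digit_words :: "nat list set" where
  "digit_words = {w. w \<noteq> [] \<and> set w \<subseteq> {2..}}"

lemma powr_prod_list:
  "(\<Prod>d\<leftarrow>w. real (f d)) powr a = (\<Prod>d\<leftarrow>w. real (f d) powr a)"
  by (induction w) (auto simp: powr_mult prod_list_nonneg)

text \<open>The heads contribute at most \<open>Z\<close>, the tails of length \<open>n\<close> at
  most \<open>\<rho> ^ n\<close>, and the geometric series in \<open>n\<close> converges.\<close>

lemma sum_word_Q_powr_bounded:
  fixes a :: real
  assumes a: "1 < a"
  obtains K where "\<And>F. finite F \<Longrightarrow> F \<subseteq> digit_words \<Longrightarrow> (\<Sum>w\<in>F. real (word_Q w) powr -a) \<le> K"
proof
  define \<rho> :: real where "\<rho> = 2 powr (1 - a)"
  have \<rho>: "0 \<le> \<rho>" "\<rho> < 1"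
    using a powr_less_mono[of "1 - a" 0 "2::real"] by (auto simp: \<rho>_def)
  define Z where "Z = (\<Sum>d. real d powr -a)"
  have summZ: "summable (\<lambda>d::nat. real d powr -a)" using a by (simp add: summable_real_powr_iff)
  \<comment> \<open>\<open>\<rho>\<close> and \<open>Z\<close> are fixed before \<open>F\<close>, so
    the bound reached at the end is a legitimate value of \<open>K\<close>. \<open>F\<close> is
    enlarged to all words with digits at most \<open>M\<close> and a tail shorter than
    \<open>N\<close>.\<close>
  fix F :: "nat list set" assume F: "finite F" "F \<subseteq> digit_words"
  define M where "M = Max (insert 0 (\<Union> (set ` F)))"
  define N where "N = Suc (Max (insert 0 (length ` F)))"
  define S where "S = (\<lambda>n. {w. set w \<subseteq> {2..M} \<and> length w = n})"
  have finS: "finite (S n)" for n unfolding S_def by (rule finite_lists_length_eq) simp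
  have inj: "inj_on (\<lambda>(n, d, w). d # w) (SIGMA n:{..<N}. {2..M} \<times> S n)"
    by (auto intro!: inj_onI simp: S_def)
  have sub: "F \<subseteq> (\<lambda>(n, d, w). d # w) ` (SIGMA n:{..<N}. {2..M} \<times> S n)"
  proof
    fix w assume w: "w \<in> F"
    then have "w \<noteq> []" "set w \<subseteq> {2..}" using F by (auto simp: digit_words_def)
    moreover have "d \<le> M" if "d \<in> set w" for d
      unfolding M_def using F(1) w that by (intro Max_ge) auto
    moreover have "length w \<le> Max (insert 0 (length ` F))"
      using F(1) w by (intro Max_ge) auto
    ultimately have "(length (tl w), hd w, tl w) \<in> (SIGMA n:{..<N}. {2..M} \<times> S n)"
      by (cases w) (auto simp: S_def N_def)
    moreover have "w = (\<lambda>(n, d, w). d # w) (length (tl w), hd w, tl w)" using \<open>w \<noteq> []\<close> by simp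
    ultimately show "w \<in> (\<lambda>(n, d, w). d # w) ` (SIGMA n:{..<N}. {2..M} \<times> S n)" by (rule rev_image_eqI)
  qed
  have weight: "real (word_Q (d # w)) powr -a =
      real d powr -a * (\<Prod>e\<leftarrow>w. real (e * (e - 1)) powr -a)" for d w
  proof -
    have "real (\<Prod>e\<leftarrow>w. e * (e - 1)) = (\<Prod>e\<leftarrow>w. real (e * (e - 1)))"
      by (induction w) auto
    then have "real (word_Q (d # w)) = real d * (\<Prod>e\<leftarrow>w. real (e * (e - 1)))"
      unfolding word_Q_def by simp
    then show ?thesis
      by (simp only: powr_prod_list[symmetric]) (simp add: powr_mult prod_list_nonneg)
  qed
  have "(\<Sum>w\<in>F. real (word_Q w) powr -a)
      \<le> (\<Sum>w\<in>(\<lambda>(n, d, w). d # w) ` (SIGMA n:{..<N}. {2..M} \<times> S n). real (word_Q w) powr -a)"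
    using sub finS by (intro sum_mono2) auto
  also have "\<dots> = (\<Sum>(n, d, w)\<in>(SIGMA n:{..<N}. {2..M} \<times> S n). real (word_Q (d # w)) powr -a)"
    using inj by (subst sum.reindex) (auto simp: case_prod_unfold)
  also have "\<dots> = (\<Sum>n<N. \<Sum>(d, w)\<in>{2..M} \<times> S n. real (word_Q (d # w)) powr -a)"
    using finS by (subst sum.Sigma) auto
  also have "\<dots> = (\<Sum>n<N. (\<Sum>d\<in>{2..M}. real d powr -a) *
      (\<Sum>w\<in>S n. \<Prod>e\<leftarrow>w. real (e * (e - 1)) powr -a))"
    unfolding weight by (simp only: sum_product sum.cartesian_product)
  also have "\<dots> \<le> (\<Sum>n<N. Z * \<rho> ^ n)"
  proof (intro sum_mono mult_mono)
    fix n
    show "(\<Sum>d\<in>{2..M}. real d powr -a) \<le> Z"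
      unfolding Z_def using summZ by (intro sum_le_suminf) auto
    show "(\<Sum>w\<in>S n. \<Prod>e\<leftarrow>w. real (e * (e - 1)) powr -a) \<le> \<rho> ^ n"
      unfolding S_def \<rho>_def sum_prod_list_lists[OF finite_atLeastAtMost]
      using a by (intro power_mono sum_pronic_powr_le sum_nonneg) auto
    show "0 \<le> (\<Sum>w\<in>S n. \<Prod>e\<leftarrow>w. real (e * (e - 1)) powr -a)"
      by (intro sum_nonneg prod_list_nonneg) auto
    show "0 \<le> Z" unfolding Z_def using summZ by (intro suminf_nonneg) auto
  qed
  also have "\<dots> \<le> Z * (1 / (1 - \<rho>))"
  proof -
    have "(\<Sum>n<N. \<rho> ^ n) \<le> (\<Sum>n. \<rho> ^ n)"
      using \<rho> by (intro sum_le_suminf) auto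
    also have "\<dots> = 1 / (1 - \<rho>)" using \<rho> by (intro suminf_geometric) auto
    finally have "(\<Sum>n<N. \<rho> ^ n) \<le> 1 / (1 - \<rho>)" .
    moreover have "0 \<le> Z" unfolding Z_def using summZ by (intro suminf_nonneg) auto
    ultimately show ?thesis by (simp only: sum_distrib_left[symmetric] mult_left_mono)
  qed
  finally show "(\<Sum>w\<in>F. real (word_Q w) powr -a) \<le> Z * (1 / (1 - \<rho>))" .
qed

text \<open>Covers are sequences, so the words are enumerated without repetition by
  \<open>list_decode\<close>; a partial sum is then a sum over a finite set of words.\<close>

lemma summable_word_Q_powr:
  fixes a :: real
  assumes "1 < a"
  shows "summable (\<lambda>i. if list_decode i \<in> digit_words then real (word_Q (list_decode i)) powr -a else 0)"
proof -
  obtain K where K: "\<And>F. finite F \<Longrightarrow> F \<subseteq> digit_words \<Longrightarrow> (\<Sum>w\<in>F. real (word_Q w) powr -a) \<le> K"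
    using sum_word_Q_powr_bounded[OF assms] by blast
  show ?thesis
  proof (rule summableI_nonneg_bounded)
    fix n
    have "(\<Sum>i<n. if list_decode i \<in> digit_words then real (word_Q (list_decode i)) powr -a else 0) =
        (\<Sum>w\<in>list_decode ` {..<n}. if w \<in> digit_words then real (word_Q w) powr -a else 0)"
      by (subst sum.reindex) (auto simp: inj_list_decode)
    also have "\<dots> = (\<Sum>w\<in>list_decode ` {..<n} \<inter> digit_words. real (word_Q w) powr -a)"
      by (rule sum.inter_restrict[symmetric]) simp
    also have "\<dots> \<le> K" by (intro K) auto
    finally show "(\<Sum>i<n. if list_decode i \<in> digit_words
      then real (word_Q (list_decode i)) powr -a else 0) \<le> K" .
  qed auto
qed

text \<open>The points with word \<open>w\<close> that are close to their convergent form a set of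
  diameter at most \<open>2 * Q powr -(1 + t)\<close> with \<open>Q = word_Q w\<close>. The
  \<open>s\<close>-th powers of these diameters are summable because
  \<open>(1 + t) * s > 1\<close>.\<close>

lemma hausdorff_measure_lueroth_limsup_set_eq_0:
  fixes s t :: real
  assumes t: "0 \<le> t" and s: "1 / (1 + t) < s"
    and \<psi>: "\<forall>\<^sub>F q in sequentially. \<psi> q \<le> real q powr -t"
  shows "hausdorff_measure s (lueroth_limsup_set \<psi>) = 0"
proof -
  obtain q0 where q0: "1 \<le> q0" "\<And>q. q0 \<le> q \<Longrightarrow> \<psi> q \<le> real q powr -t"
    using \<psi> unfolding eventually_sequentially by (metis le_trans linear)
  have s0: "0 < s" using t s by (meson divide_nonneg_nonneg add_nonneg_nonneg le_less_trans zero_le_one)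
  define a where "a = (1 + t) * s"
  have a: "1 < a" using s t unfolding a_def by (simp add: field_simps)
  define near where "near = (\<lambda>n x.
    \<bar>x - lueroth_P n x / real (lueroth_Q n x)\<bar> < \<psi> (lueroth_Q n x) / real (lueroth_Q n x))"
  \<comment> \<open>The set is empty unless \<open>w\<close> is a digit word with
    \<open>word_Q w\<close> at least \<open>q0\<close>, where the bound on \<open>\<psi>\<close> is
    available.\<close>
  define V where "V = (\<lambda>w. {x \<in> {0<..1}. w \<in> digit_words \<and> q0 \<le> word_Q w \<and>
    digit_word (length w) x = w \<and> near (length w) x})"
  have diam: "diameter (V w) powr s
      \<le> 2 powr s * (if w \<in> digit_words then real (word_Q w) powr -a else 0)" for w
  proof (cases "V w = {}")
    case False
    then have w: "w \<in> digit_words" "q0 \<le> word_Q w" by (auto simp: V_def)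
    have Q: "lueroth_Q (length w) x = word_Q w" if "x \<in> V w" for x
    proof -
      obtain n where "length w = Suc n" using w by (cases w) (auto simp: digit_words_def)
      then show ?thesis using word_Q_digit_word[of n x] that by (auto simp: V_def)
    qed
    have "dist x y \<le> 2 * real (word_Q w) powr -(1 + t)" if xy: "x \<in> V w" "y \<in> V w" for x y
    proof -
      have "lueroth_P (length w) x / real (lueroth_Q (length w) x) =
          lueroth_P (length w) y / real (lueroth_Q (length w) y)"
        using xy by (intro convergent_eq_if_digit_word_eq) (auto simp: V_def)
      moreover have "near (length w) x" "near (length w) y" using xy by (auto simp: V_def)
      ultimately have "\<bar>x - y\<bar> \<le> 2 * (\<psi> (word_Q w) / real (word_Q w))"
        unfolding near_def Q[OF xy(1)] Q[OF xy(2)] by linarith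
      also have "\<dots> \<le> 2 * (real (word_Q w) powr -t / real (word_Q w))"
        using q0 w by (intro mult_left_mono divide_right_mono) auto
      also have "\<dots> = 2 * real (word_Q w) powr -(1 + t)"
        using q0 w by (simp add: powr_diff powr_minus field_simps)
      finally show ?thesis by (simp add: dist_real_def)
    qed
    then have "diameter (V w) \<le> 2 * real (word_Q w) powr -(1 + t)"
      using False by (intro diameter_le) (auto simp: dist_norm)
    then have "diameter (V w) powr s \<le> (2 * real (word_Q w) powr -(1 + t)) powr s"
      using s0 by (intro powr_mono2 diameter_ge_0) (auto simp: V_def intro: bounded_subset[of "{0..1}"])
    also have "\<dots> = 2 powr s * real (word_Q w) powr -a"
      by (simp add: powr_mult powr_powr a_def algebra_simps)
    finally show ?thesis using w by simp
  qed (auto simp: diameter_def)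
  show ?thesis
  proof (rule hausdorff_measure_limsup_eq_0[OF s0])
    show "bounded (V (list_decode i))" for i
      by (rule bounded_subset[of "{0..1}"]) (auto simp: V_def)
    show "summable (\<lambda>i. diameter (V (list_decode i)) powr s)"
      by (rule summable_comparison_test'[OF
            summable_mult[OF summable_word_Q_powr[OF a], where c = "2 powr s"], of 0])
         (simp only: real_norm_def abs_of_nonneg[OF powr_ge_zero] diam)
    fix x assume "x \<in> lueroth_limsup_set \<psi>"
    then have x: "x \<in> {0<..1}" and fr: "\<exists>\<^sub>F n in sequentially. near n x"
      by (auto simp: lueroth_limsup_set_def near_def)
    have ev: "\<forall>\<^sub>F n in sequentially. q0 \<le> lueroth_Q n x \<and> 1 \<le> n"
      using filterlim_lueroth_Q[OF x] by (auto simp: filterlim_at_top eventually_ge_at_top intro: eventually_conj)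
    have "\<exists>\<^sub>F n in sequentially. near n x \<and> q0 \<le> lueroth_Q n x \<and> 1 \<le> n"
      using frequently_eventually_conj[OF fr ev] by (rule frequently_elim1) blast
    then have inf: "infinite {n. near n x \<and> q0 \<le> lueroth_Q n x \<and> 1 \<le> n}" (is "infinite ?N")
      unfolding cofinite_eq_sequentially[symmetric] frequently_cofinite .
    \<comment> \<open>A word determines its length, so infinitely many good \<open>n\<close> give
      infinitely many covering sets containing \<open>x\<close>.\<close>
    have "inj_on (\<lambda>n. list_encode (digit_word n x)) ?N"
      by (rule inj_onI) (metis list_encode_eq length_digit_word)
    then have "infinite ((\<lambda>n. list_encode (digit_word n x)) ` ?N)"
      using inf finite_imageD by blast
    moreover have "(\<lambda>n. list_encode (digit_word n x)) ` ?N \<subseteq> {i. x \<in> V (list_decode i)}"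
    proof clarsimp
      fix n assume n: "near n x" "q0 \<le> lueroth_Q n x" "Suc 0 \<le> n"
      then obtain m where "n = Suc m" by (cases n) auto
      then have "word_Q (digit_word n x) = lueroth_Q n x" using word_Q_digit_word by simp
      moreover have "digit_word n x \<in> digit_words"
        using n(3) lueroth_digit_ge_2[OF x] by (auto simp: digit_words_def digit_word_def)
      ultimately show "x \<in> V (digit_word n x)" using n x by (simp add: V_def)
    qed
    ultimately have "infinite {i. x \<in> V (list_decode i)}" using infinite_super by blast
    then show "\<exists>\<^sub>F i in sequentially. x \<in> V (list_decode i)"
      unfolding cofinite_eq_sequentially[symmetric] frequently_cofinite .
  qed
qed

section \<open>The lower bound\<close>

definition first_digit :: "real \<Rightarrow> nat" where
  "first_digit u = nat (\<lfloor>1 / u\<rfloor> + 1)"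

text \<open>Moving \<open>u\<close> into \<open>(0, 1/m]\<close> forces the digit beyond
  \<open>m\<close>; this is how good approximations are created.\<close>

lemma first_digit_bounds:
  assumes "0 < u" "u * real m \<le> 1" "1 \<le> m"
  shows "m + 1 \<le> first_digit u" "1 / real (first_digit u) < u" "u \<le> 1 / (real (first_digit u) - 1)"
proof -
  have "real m \<le> 1 / u" using assms by (simp add: field_simps)
  then have fl: "int m \<le> \<lfloor>1 / u\<rfloor>" by (simp add: le_floor_iff)
  then show *: "m + 1 \<le> first_digit u" unfolding first_digit_def by linarith
  have c: "real (first_digit u) = of_int \<lfloor>1 / u\<rfloor> + 1" using fl unfolding first_digit_def by linarith
  have "1 / u < real (first_digit u)" "real (first_digit u) - 1 \<le> 1 / u" unfolding c by linarith+
  then show "1 / real (first_digit u) < u" "u \<le> 1 / (real (first_digit u) - 1)"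
    using assms * by (auto simp: field_simps)
qed

lemma first_digit_antimono:
  assumes "0 < u" "u \<le> v"
  shows "first_digit v \<le> first_digit u"
  unfolding first_digit_def using assms by (intro nat_mono add_right_mono floor_mono) (simp add: frac_le)

lemma one_le_twice_powr:
  fixes s :: real
  assumes "0 \<le> s" "s \<le> 1" "1 / 2 \<le> v"
  shows "1 \<le> 2 * v powr s"
proof -
  have "(1 / 2) powr 1 \<le> (1 / 2) powr (s::real)" using assms by (intro powr_mono') auto
  also have "\<dots> \<le> v powr s" using assms by (intro powr_mono2) auto
  finally show ?thesis by simp
qed

text \<open>A node of the construction is a finite digit word of length \<open>n\<close>; \<open>scale\<close> is the reciprocal
  length of its cylinder, \<open>den\<close> is \<open>Q\<^sub>n\<close>, and \<open>mass / scale\<close> is the length of the interval of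
  points of \<open>(0,1]\<close> that are sent to this cylinder. The relative position of the given point in
  the latter interval is \<open>pos\<close>.\<close>

datatype state = State (pos: real) (den: real) (scale: real) (mass: real)

text \<open>\<open>s\<close> is the Hausdorff exponent to be reached, and \<open>q powr -t\<close>
  is the precision to be met for denominators from \<open>q0\<close> on. \<open>exponent\<close> is
  \<open>s < 1 / (1 + t)\<close> without division.\<close>

locale sparse_lueroth =
  fixes s t :: real and q0 :: nat
  assumes s_pos: "0 < s" and t_nonneg: "0 \<le> t" and exponent: "s * (1 + t) < 1" and q0: "1 \<le> q0"
begin

lemma s_less_1: "s < 1"
proof -
  have "s * 1 \<le> s * (1 + t)" using s_pos t_nonneg by (intro mult_left_mono) auto
  then show ?thesis using exponent by simp
qed

text \<open>Adding \<open>2\<close> makes the value exceed \<open>q powr t\<close> and also be at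
  least \<open>2\<close>, so an exceptional stage never has contraction \<open>1\<close> and its
  digit is at least \<open>3\<close>.\<close>

definition bound :: "real \<Rightarrow> nat" where
  "bound q = nat \<lfloor>q powr t\<rfloor> + 2"

lemma bound_gt: "q powr t < real (bound q)"
proof -
  have "0 \<le> \<lfloor>q powr t\<rfloor>" by simp
  then have "real (nat \<lfloor>q powr t\<rfloor>) = of_int \<lfloor>q powr t\<rfloor>" by simp
  then show ?thesis unfolding bound_def by (simp only: of_nat_add) linarith
qed

lemma bound_le: "real (bound q) \<le> q powr t + 2"
proof -
  have "0 \<le> \<lfloor>q powr t\<rfloor>" by simp
  then have "real (nat \<lfloor>q powr t\<rfloor>) = of_int \<lfloor>q powr t\<rfloor>" by simp
  then show ?thesis unfolding bound_def by (simp only: of_nat_add) linarith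
qed

text \<open>The value \<open>1\<close> means plain copying. An exceptional stage is allowed once
  \<open>scale\<close> is large against the accumulated \<open>mass\<close>. Only
  \<open>m powr s\<close> is charged, since the digit above \<open>m\<close> that follows pays for
  \<open>m powr (1 - s)\<close>.\<close>

definition contraction :: "state \<Rightarrow> nat" where
  "contraction \<sigma> =
     (if real q0 \<le> den \<sigma> \<and> mass \<sigma> * real (bound (den \<sigma>)) powr s \<le> scale \<sigma> powr (1 - s)
      then bound (den \<sigma>) else 1)"

definition digit :: "state \<Rightarrow> nat" where
  "digit \<sigma> = first_digit (pos \<sigma> / real (contraction \<sigma>))"

text \<open>The Lueroth shift acts on \<open>pos / m\<close>. The digit is \<open>c\<close> when
  \<open>pos\<close> lies in an interval of length \<open>m / (c (c - 1))\<close>, so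
  \<open>mass\<close> gains the factor \<open>m\<close> and \<open>scale\<close> the factor
  \<open>c (c - 1)\<close>.\<close>

definition step :: "state \<Rightarrow> state" where
  "step \<sigma> = (let c = real (digit \<sigma>); m = real (contraction \<sigma>) in
     State (c * (c - 1) * (pos \<sigma> / m) - (c - 1)) (c * scale \<sigma>) (c * (c - 1) * scale \<sigma>) (mass \<sigma> * m))"

text \<open>The last inequality amounts to \<open>mass / scale \<le> (1 / scale) powr s\<close>, the
  Hoelder bound for whole cylinders.\<close>

definition valid :: "state \<Rightarrow> bool" where
  "valid \<sigma> \<longleftrightarrow> 0 < pos \<sigma> \<and> pos \<sigma> \<le> 1 \<and> 1 \<le> scale \<sigma> \<and> 1 \<le> mass \<sigma> \<and>
     mass \<sigma> \<le> scale \<sigma> powr (1 - s)"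

lemma step_simps [simp]:
  "pos (step \<sigma>) = real (digit \<sigma>) * (real (digit \<sigma>) - 1) * (pos \<sigma> / real (contraction \<sigma>)) - (real (digit \<sigma>) - 1)"
  "den (step \<sigma>) = real (digit \<sigma>) * scale \<sigma>"
  "scale (step \<sigma>) = real (digit \<sigma>) * (real (digit \<sigma>) - 1) * scale \<sigma>"
  "mass (step \<sigma>) = mass \<sigma> * real (contraction \<sigma>)"
  by (simp_all add: step_def Let_def)

lemma contraction_ge_1: "1 \<le> contraction \<sigma>"
  by (simp add: contraction_def bound_def)

lemma contraction_mass:
  assumes "valid \<sigma>"
  shows "mass \<sigma> * real (contraction \<sigma>) powr s \<le> scale \<sigma> powr (1 - s)"
  using assms by (simp add: contraction_def valid_def)

lemma digit_bounds:
  assumes "valid \<sigma>"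
  shows "contraction \<sigma> + 1 \<le> digit \<sigma>" "2 \<le> digit \<sigma>"
    "1 / real (digit \<sigma>) < pos \<sigma> / real (contraction \<sigma>)"
    "pos \<sigma> / real (contraction \<sigma>) \<le> 1 / (real (digit \<sigma>) - 1)"
proof -
  have "0 < pos \<sigma> / real (contraction \<sigma>)" "pos \<sigma> / real (contraction \<sigma>) * real (contraction \<sigma>) \<le> 1"
    using assms contraction_ge_1[of \<sigma>] by (auto simp: valid_def)
  note * = first_digit_bounds[OF this contraction_ge_1]
  show "contraction \<sigma> + 1 \<le> digit \<sigma>" "1 / real (digit \<sigma>) < pos \<sigma> / real (contraction \<sigma>)"
    "pos \<sigma> / real (contraction \<sigma>) \<le> 1 / (real (digit \<sigma>) - 1)"
    unfolding digit_def by (fact *)+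
  then show "2 \<le> digit \<sigma>" using contraction_ge_1[of \<sigma>] by linarith
qed

text \<open>Write \<open>mass * m\<close> as \<open>(mass * m powr s) * m powr (1 - s)\<close>: the
  test in \<open>contraction\<close> bounds the first factor, and the new factor
  \<open>c (c - 1) \<ge> m\<close> of \<open>scale\<close> bounds the second.\<close>

lemma valid_step:
  assumes "valid \<sigma>"
  shows "valid (step \<sigma>)"
proof -
  define c m where "c = real (digit \<sigma>)" and "m = real (contraction \<sigma>)"
  define u where "u = pos \<sigma> / m"
  have m: "1 \<le> m" using contraction_ge_1[of \<sigma>] by (simp add: m_def)
  have cm: "m \<le> c - 1" using digit_bounds(1)[OF assms] unfolding c_def m_def by linarith
  have u: "1 / c < u" "u \<le> 1 / (c - 1)"
    using digit_bounds(3,4)[OF assms] by (auto simp: c_def u_def m_def)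
  have v: "1 \<le> scale \<sigma>" "1 \<le> mass \<sigma>" using assms by (auto simp: valid_def)
  have "0 < (c - 1) * (c * u - 1)" using u m cm by (intro mult_pos_pos) (auto simp: field_simps)
  moreover have "c * ((c - 1) * u) \<le> c * 1" using u m cm by (intro mult_left_mono) (auto simp: field_simps)
  moreover have "1 * 1 \<le> c * (c - 1)" using m cm by (intro mult_mono) auto
  then have "1 * 1 \<le> c * (c - 1) * scale \<sigma>" using v by (intro mult_mono) auto
  moreover have "1 * 1 \<le> mass \<sigma> * m" using v m by (intro mult_mono) auto
  moreover have "mass \<sigma> * m \<le> (c * (c - 1) * scale \<sigma>) powr (1 - s)"
  proof -
    have "mass \<sigma> * m = (mass \<sigma> * m powr s) * m powr (1 - s)"
      using m by (simp add: powr_add[symmetric])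
    also have "\<dots> \<le> scale \<sigma> powr (1 - s) * (c * (c - 1)) powr (1 - s)"
    proof (intro mult_mono powr_mono2)
      show "mass \<sigma> * m powr s \<le> scale \<sigma> powr (1 - s)"
        unfolding m_def by (rule contraction_mass[OF assms])
      show "m \<le> c * (c - 1)" using mult_mono[of 1 c m "c - 1"] m cm by simp
    qed (use s_less_1 m in auto)
    also have "\<dots> = (c * (c - 1) * scale \<sigma>) powr (1 - s)"
      using m cm v by (subst powr_mult[symmetric]) (auto simp: mult_ac)
    finally show ?thesis .
  qed
  ultimately show ?thesis
    unfolding valid_def step_simps c_def[symmetric] m_def[symmetric] u_def[symmetric]
    by (auto simp: algebra_simps)
qed

lemma valid_funpow:
  assumes "valid \<sigma>"
  shows "valid ((step ^^ n) \<sigma>)"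
  by (induction n) (auto simp: assms valid_step)

section \<open>Image points and endpoints of cylinders\<close>

definition digits :: "state \<Rightarrow> nat \<Rightarrow> nat" where
  "digits \<sigma> k = (if k = 0 then 0 else digit ((step ^^ (k - 1)) \<sigma>))"

text \<open>At the root this is the map into the limsup set; at a later state it is the relative
  position of the image point in the current cylinder.\<close>

definition val :: "state \<Rightarrow> real" where
  "val \<sigma> = (\<Sum>k. 1 / real (lueroth_denom (digits \<sigma>) (Suc k)))"

lemma is_lueroth_expansion_val:
  assumes "valid \<sigma>"
  shows "is_lueroth_expansion (digits \<sigma>) (val \<sigma>)"
proof -
  have d: "2 \<le> digits \<sigma> k" if "1 \<le> k" for k
    using that digit_bounds(2)[OF valid_funpow[OF assms]] by (simp add: digits_def)
  have "summable (\<lambda>k. 1 / real (lueroth_denom (digits \<sigma>) (Suc k)))"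
    by (rule summableI_nonneg_bounded[OF _ lueroth_partial_sum_le[OF d]]) auto
  then show ?thesis
    unfolding is_lueroth_expansion_def val_def using d by (auto simp: digits_def)
qed

lemma digits_step: "digits (step \<sigma>) = (\<lambda>j. if j = 0 then 0 else digits \<sigma> (Suc j))"
proof
  fix j show "digits (step \<sigma>) j = (if j = 0 then 0 else digits \<sigma> (Suc j))"
    by (cases j) (simp_all add: digits_def funpow_swap1)
qed

lemma val_step:
  assumes "valid \<sigma>"
  shows "val (step \<sigma>) = real (digit \<sigma>) * (real (digit \<sigma>) - 1) * val \<sigma> - (real (digit \<sigma>) - 1)"
proof -
  have "is_lueroth_expansion (digits (step \<sigma>))
      (real (digit \<sigma>) * (real (digit \<sigma>) - 1) * val \<sigma> - (real (digit \<sigma>) - 1))"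
    using lueroth_expansion_step(1)[OF is_lueroth_expansion_val[OF assms]]
    unfolding digits_step by (simp add: digits_def)
  then show ?thesis
    using is_lueroth_expansion_val[OF valid_step[OF assms]]
    unfolding is_lueroth_expansion_def by (blast intro: sums_unique2)
qed

lemma val_bounds:
  assumes "valid \<sigma>"
  shows "0 < val \<sigma>" "val \<sigma> \<le> 1"
    "1 / real (digit \<sigma>) < val \<sigma>" "val \<sigma> \<le> 1 / (real (digit \<sigma>) - 1)"
proof -
  show "0 < val \<sigma>" "val \<sigma> \<le> 1"
    using lueroth_expansion_pos_le[OF is_lueroth_expansion_val[OF assms]] by auto
  define c where "c = real (digit \<sigma>)"
  have c: "2 \<le> c" using digit_bounds(2)[OF assms] by (simp add: c_def)
  have "0 < c * (c - 1) * val \<sigma> - (c - 1)" "c * (c - 1) * val \<sigma> - (c - 1) \<le> 1"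
    using lueroth_expansion_pos_le[OF is_lueroth_expansion_val[OF valid_step[OF assms]]]
    unfolding val_step[OF assms] by (auto simp: c_def)
  then have "0 < (c - 1) * (c * val \<sigma> - 1)" "c * ((c - 1) * val \<sigma>) \<le> c * 1"
    by (auto simp: algebra_simps)
  then have "0 < c * val \<sigma> - 1" "(c - 1) * val \<sigma> \<le> 1"
    using c by (simp_all only: zero_less_mult_iff mult_le_cancel_left_pos) auto
  then show "1 / real (digit \<sigma>) < val \<sigma>" "val \<sigma> \<le> 1 / (real (digit \<sigma>) - 1)"
    unfolding c_def[symmetric] using c by (auto simp: field_simps)
qed

text \<open>\<open>mass / scale\<close> turns relative positions into lengths in
  \<open>(0,1]\<close>, and \<open>1 / scale\<close> does so for images. Each identity measures the
  distance to the left endpoint \<open>1 / c\<close> of the child cylinder, once from the child and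
  once from the parent.\<close>

lemma step_left:
  assumes "valid \<sigma>"
  shows "mass (step \<sigma>) / scale (step \<sigma>) * pos (step \<sigma>) =
      mass \<sigma> / scale \<sigma> * (real (contraction \<sigma>) * (pos \<sigma> / real (contraction \<sigma>) - 1 / real (digit \<sigma>)))"
    and "val (step \<sigma>) / scale (step \<sigma>) = (val \<sigma> - 1 / real (digit \<sigma>)) / scale \<sigma>"
proof -
  define c m where "c = real (digit \<sigma>)" and "m = real (contraction \<sigma>)"
  have c: "c \<noteq> 0" "c - 1 \<noteq> 0" using digit_bounds(2)[OF assms] by (auto simp: c_def)
  have sc: "scale \<sigma> \<noteq> 0" using assms by (auto simp: valid_def)
  have *: "c * (c - 1) * x - (c - 1) = c * (c - 1) * (x - 1 / c)" for x
    using c by (simp add: field_simps)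
  show "mass (step \<sigma>) / scale (step \<sigma>) * pos (step \<sigma>) =
      mass \<sigma> / scale \<sigma> * (real (contraction \<sigma>) * (pos \<sigma> / real (contraction \<sigma>) - 1 / real (digit \<sigma>)))"
    unfolding step_simps c_def[symmetric] m_def[symmetric] * using c sc by simp
  show "val (step \<sigma>) / scale (step \<sigma>) = (val \<sigma> - 1 / real (digit \<sigma>)) / scale \<sigma>"
    unfolding step_simps val_step[OF assms] c_def[symmetric] * using c sc by simp
qed

lemma step_right:
  assumes "valid \<sigma>"
  shows "mass (step \<sigma>) / scale (step \<sigma>) * (1 - pos (step \<sigma>)) =
      mass \<sigma> / scale \<sigma> *
        (real (contraction \<sigma>) * (1 / (real (digit \<sigma>) - 1) - pos \<sigma> / real (contraction \<sigma>)))"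
    and "(1 - val (step \<sigma>)) / scale (step \<sigma>) = (1 / (real (digit \<sigma>) - 1) - val \<sigma>) / scale \<sigma>"
proof -
  define c m where "c = real (digit \<sigma>)" and "m = real (contraction \<sigma>)"
  have c: "c \<noteq> 0" "c - 1 \<noteq> 0" using digit_bounds(2)[OF assms] by (auto simp: c_def)
  have sc: "scale \<sigma> \<noteq> 0" using assms by (auto simp: valid_def)
  have *: "1 - (c * (c - 1) * x - (c - 1)) = c * (c - 1) * (1 / (c - 1) - x)" for x
    using c by (simp add: field_simps)
  show "mass (step \<sigma>) / scale (step \<sigma>) * (1 - pos (step \<sigma>)) =
      mass \<sigma> / scale \<sigma> *
        (real (contraction \<sigma>) * (1 / (real (digit \<sigma>) - 1) - pos \<sigma> / real (contraction \<sigma>)))"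
    unfolding step_simps c_def[symmetric] m_def[symmetric] * using c sc by simp
  show "(1 - val (step \<sigma>)) / scale (step \<sigma>) = (1 / (real (digit \<sigma>) - 1) - val \<sigma>) / scale \<sigma>"
    unfolding step_simps val_step[OF assms] c_def[symmetric] * using c sc by simp
qed

section \<open>Hoelder estimates towards the endpoints of a cylinder\<close>

text \<open>As \<open>m * v \<le> 1\<close>, it is at most \<open>(m * v) powr s\<close>; the charge
  \<open>mass * m powr s \<le> scale powr (1 - s)\<close> absorbs the rest.\<close>

lemma mass_estimate:
  assumes "valid \<sigma>" and v: "0 \<le> v" "real (contraction \<sigma>) * v \<le> 1"
  shows "mass \<sigma> / scale \<sigma> * (real (contraction \<sigma>) * v) \<le> (v / scale \<sigma>) powr s"
proof (cases "v = 0")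
  case False
  define m where "m = real (contraction \<sigma>)"
  have m: "1 \<le> m" using contraction_ge_1[of \<sigma>] by (simp add: m_def)
  have sc: "1 \<le> scale \<sigma>" "1 \<le> mass \<sigma>" using assms by (auto simp: valid_def)
  have "m * v = (m * v) powr s * (m * v) powr (1 - s)"
    using m v False by (simp add: powr_add[symmetric])
  also have "\<dots> \<le> (m * v) powr s * 1"
    using m v False s_less_1 unfolding m_def by (intro mult_left_mono powr_le1) auto
  finally have "m * v \<le> m powr s * v powr s" using m v by (simp add: powr_mult)
  then have "mass \<sigma> / scale \<sigma> * (m * v) \<le> mass \<sigma> / scale \<sigma> * (m powr s * v powr s)"
    using sc by (intro mult_left_mono) auto
  also have "\<dots> = (mass \<sigma> * m powr s) * (v powr s / scale \<sigma>)" by simp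
  also have "\<dots> \<le> scale \<sigma> powr (1 - s) * (v powr s / scale \<sigma>)"
    using contraction_mass[OF assms(1)] sc unfolding m_def by (intro mult_right_mono) auto
  also have "\<dots> = (v / scale \<sigma>) powr s"
    using sc v by (simp add: powr_diff powr_divide)
  finally show ?thesis unfolding m_def .
qed simp

text \<open>\<open>pos / m\<close> and \<open>val\<close> lie in the same interval
  \<open>(1/c, 1/(c - 1)]\<close>, whose endpoints differ by a factor of at most \<open>2\<close>
  because \<open>c \<ge> 2\<close>. This reduces the claim to \<open>mass_estimate\<close> with
  \<open>v = val\<close>.\<close>

lemma left_estimate:
  assumes "valid \<sigma>"
  shows "mass \<sigma> / scale \<sigma> * pos \<sigma> \<le> 2 * (val \<sigma> / scale \<sigma>) powr s"
proof -
  define c m where "c = real (digit \<sigma>)" and "m = real (contraction \<sigma>)"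
  have m: "1 \<le> m" using contraction_ge_1[of \<sigma>] by (simp add: m_def)
  have cm: "m \<le> c - 1" using digit_bounds(1)[OF assms] unfolding c_def m_def by linarith
  have sc: "1 \<le> scale \<sigma>" "1 \<le> mass \<sigma>" using assms by (auto simp: valid_def)
  have "pos \<sigma> / m \<le> 1 / (c - 1)" using digit_bounds(4)[OF assms] by (simp add: c_def m_def)
  also have "\<dots> \<le> 2 * (1 / c)" using m cm by (simp add: field_simps)
  also have "\<dots> \<le> 2 * val \<sigma>" using val_bounds(3)[OF assms] unfolding c_def by (intro mult_left_mono) auto
  finally have "pos \<sigma> \<le> 2 * (m * val \<sigma>)" using m by (simp add: field_simps)
  then have "mass \<sigma> / scale \<sigma> * pos \<sigma> \<le> mass \<sigma> / scale \<sigma> * (2 * (m * val \<sigma>))"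
    using sc by (intro mult_left_mono) auto
  also have "\<dots> = 2 * (mass \<sigma> / scale \<sigma> * (m * val \<sigma>))" by simp
  also have "\<dots> \<le> 2 * (val \<sigma> / scale \<sigma>) powr s"
  proof -
    have "m * val \<sigma> \<le> (c - 1) * (1 / (c - 1))"
      using cm m val_bounds(1,4)[OF assms] unfolding c_def by (intro mult_mono) auto
    then have "m * val \<sigma> \<le> 1" using cm m by simp
    then show ?thesis
      using mass_estimate[OF assms less_imp_le[OF val_bounds(1)[OF assms]]] by (simp add: m_def)
  qed
  finally show ?thesis .
qed

text \<open>A digit of at least \<open>3\<close> keeps \<open>val\<close> at most
  \<open>1/2\<close>, so the distance to the right endpoint is comparable with the whole cylinder,
  for which validity suffices.\<close>

lemma right_estimate_if_digit_ge_3: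
  assumes "valid \<sigma>" "3 \<le> digit \<sigma>"
  shows "mass \<sigma> / scale \<sigma> * (1 - pos \<sigma>) \<le> 2 * ((1 - val \<sigma>) / scale \<sigma>) powr s"
proof -
  have sc: "1 \<le> scale \<sigma>" "1 \<le> mass \<sigma>" "mass \<sigma> \<le> scale \<sigma> powr (1 - s)" "0 < pos \<sigma>"
    using \<open>valid \<sigma>\<close> by (auto simp: valid_def)
  have c: "3 \<le> real (digit \<sigma>)" using assms by simp
  have "val \<sigma> \<le> 1 / (real (digit \<sigma>) - 1)" by (rule val_bounds(4)[OF \<open>valid \<sigma>\<close>])
  also have "\<dots> \<le> 1 / 2" using c by (intro divide_left_mono) auto
  finally have v: "1 / 2 \<le> 1 - val \<sigma>" by simp
  have "mass \<sigma> / scale \<sigma> * (1 - pos \<sigma>) \<le> mass \<sigma> / scale \<sigma> * 1"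
    using sc by (intro mult_left_mono) auto
  also have "\<dots> \<le> scale \<sigma> powr (1 - s) / scale \<sigma>"
    using sc by (simp add: divide_right_mono)
  also have "\<dots> = 1 / scale \<sigma> powr s" using sc by (simp add: powr_diff)
  also have "\<dots> \<le> 2 * (1 - val \<sigma>) powr s / scale \<sigma> powr s"
    using one_le_twice_powr[OF _ _ v, of s] s_pos s_less_1 by (intro divide_right_mono) auto
  also have "\<dots> = 2 * ((1 - val \<sigma>) / scale \<sigma>) powr s"
    using v sc by (simp add: powr_divide)
  finally show ?thesis .
qed

text \<open>As long as the digit is \<open>2\<close>, the right endpoints of the cylinder and of its child coincide,
  so the inequality may be checked at the first later node with a larger digit.\<close>

lemma right_estimate_if_later_digit_ge_3:
  assumes "valid \<sigma>" "3 \<le> digit ((step ^^ n) \<sigma>)"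
  shows "mass \<sigma> / scale \<sigma> * (1 - pos \<sigma>) \<le> 2 * ((1 - val \<sigma>) / scale \<sigma>) powr s"
  using assms
proof (induction n arbitrary: \<sigma>)
  case 0
  then show ?case by (intro right_estimate_if_digit_ge_3) auto
next
  case (Suc n)
  show ?case
  proof (cases "3 \<le> digit \<sigma>")
    case True
    then show ?thesis using Suc.prems by (intro right_estimate_if_digit_ge_3)
  next
    case False
    then have c: "digit \<sigma> = 2" "contraction \<sigma> = 1"
      using digit_bounds(1,2)[OF Suc.prems(1)] contraction_ge_1[of \<sigma>] by auto
    have "mass (step \<sigma>) / scale (step \<sigma>) * (1 - pos (step \<sigma>))
        \<le> 2 * ((1 - val (step \<sigma>)) / scale (step \<sigma>)) powr s"
      using Suc.prems by (intro Suc.IH valid_step) (auto simp: funpow_swap1)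
    then show ?thesis
      unfolding step_right[OF Suc.prems(1)] c by simp
  qed
qed

lemma scale_step_ge:
  assumes "valid \<sigma>"
  shows "2 * scale \<sigma> \<le> den (step \<sigma>)" "den (step \<sigma>) \<le> scale (step \<sigma>)"
proof -
  have c: "2 \<le> real (digit \<sigma>)" "1 \<le> real (digit \<sigma>) - 1" using digit_bounds(2)[OF assms] by auto
  have sc: "1 \<le> scale \<sigma>" using assms by (auto simp: valid_def)
  show "2 * scale \<sigma> \<le> den (step \<sigma>)" using c sc by simp
  have "real (digit \<sigma>) * scale \<sigma> * 1 \<le> real (digit \<sigma>) * scale \<sigma> * (real (digit \<sigma>) - 1)"
    using c sc by (intro mult_left_mono) auto
  then show "den (step \<sigma>) \<le> scale (step \<sigma>)" by (simp add: mult_ac)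
qed

lemma scale_funpow_ge:
  assumes "valid \<sigma>"
  shows "2 ^ n \<le> scale ((step ^^ n) \<sigma>)"
proof (induction n)
  case 0
  then show ?case using assms by (simp add: valid_def)
next
  case (Suc n)
  then show ?case
    using scale_step_ge[OF valid_funpow[OF assms, of n]] by (simp del: step_simps)
qed

text \<open>\<open>bound q\<close> is at most \<open>3 * q powr t\<close> for
  \<open>q \<ge> 1\<close>, and the strict inequality \<open>s * (1 + t) < 1\<close> leaves a
  positive power of \<open>q\<close> that outgrows any constant.\<close>

lemma eventually_mass_bound:
  "\<forall>\<^sub>F q in at_top. R * real (bound q) powr s \<le> q powr (1 - s)"
proof -
  have e: "0 < 1 - s - t * s" using exponent by (simp add: algebra_simps)
  define K where "K = \<bar>R\<bar> * 3 powr s"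
  have "\<forall>\<^sub>F q in at_top. K \<le> q powr (1 - s - t * s)"
    using eventually_ge_at_top[of "K powr (1 / (1 - s - t * s))"]
  proof eventually_elim
    case (elim q)
    have "K = (K powr (1 / (1 - s - t * s))) powr (1 - s - t * s)"
      using e by (simp add: powr_powr K_def)
    also have "\<dots> \<le> q powr (1 - s - t * s)" using elim e by (intro powr_mono2) auto
    finally show ?case .
  qed
  then show ?thesis
    using eventually_ge_at_top[of 1]
  proof eventually_elim
    case (elim q)
    have "1 \<le> q powr t" using elim t_nonneg by (intro ge_one_powr_ge_zero) auto
    then have "real (bound q) \<le> 3 * q powr t" using bound_le[of q] by linarith
    then have "real (bound q) powr s \<le> (3 * q powr t) powr s"
      using s_pos by (intro powr_mono2) auto
    also have "\<dots> = 3 powr s * q powr (t * s)" by (simp add: powr_mult powr_powr)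
    finally have "R * real (bound q) powr s \<le> \<bar>R\<bar> * (3 powr s * q powr (t * s))"
      by (intro mult_mono) auto
    also have "\<dots> = K * q powr (t * s)" by (simp add: K_def)
    also have "\<dots> \<le> q powr (1 - s - t * s) * q powr (t * s)"
      using elim by (intro mult_right_mono) auto
    also have "\<dots> = q powr (1 - s)" by (simp add: powr_add[symmetric])
    finally show ?case .
  qed
qed

text \<open>Without exceptional stages \<open>mass\<close> would stay constant while
  \<open>den\<close> grows at least like \<open>2 ^ n\<close>, so the test in
  \<open>contraction\<close> would eventually succeed.\<close>

lemma exists_contraction:
  assumes "valid \<sigma>"
  shows "\<exists>n. real q0 \<le> den ((step ^^ n) \<sigma>) \<and>
    contraction ((step ^^ n) \<sigma>) = bound (den ((step ^^ n) \<sigma>))"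
proof (rule ccontr)
  assume "\<not> ?thesis"
  then have one: "contraction ((step ^^ n) \<sigma>) = 1" for n
    unfolding contraction_def by metis
  have mass: "mass ((step ^^ n) \<sigma>) = mass \<sigma>" for n
    by (induction n) (auto simp: one)
  obtain N where N: "\<And>q. N \<le> q \<Longrightarrow> mass \<sigma> * real (bound q) powr s \<le> q powr (1 - s)"
    using eventually_mass_bound[of "mass \<sigma>"] unfolding eventually_at_top_linorder by blast
  obtain n where n: "max N (real q0) < 2 ^ n"
    using real_arch_pow[of 2 "max N (real q0)"] by auto
  define \<tau> where "\<tau> = (step ^^ Suc n) \<sigma>"
  have step: "2 * scale ((step ^^ n) \<sigma>) \<le> den \<tau>" "den \<tau> \<le> scale \<tau>"
    unfolding \<tau>_def using scale_step_ge[OF valid_funpow[OF assms, of n]] by simp_all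
  then have "2 * 2 ^ n \<le> den \<tau>" using scale_funpow_ge[OF assms, of n] by linarith
  then have den: "max N (real q0) \<le> den \<tau>"
    using n one_le_power[of "2::real" n] by linarith
  have "mass \<tau> * real (bound (den \<tau>)) powr s \<le> den \<tau> powr (1 - s)"
    using N[of "den \<tau>"] den mass[of "Suc n"] unfolding \<tau>_def by simp
  also have "\<dots> \<le> scale \<tau> powr (1 - s)"
    using step den s_less_1 by (intro powr_mono2) auto
  finally have "contraction \<tau> = bound (den \<tau>)" using den by (simp add: contraction_def)
  then show False using one[of "Suc n"] unfolding \<tau>_def bound_def by simp
qed

text \<open>An exceptional stage occurs at the state or after it, and its digit exceeds
  \<open>bound\<close>, which is at least \<open>2\<close>.\<close>

lemma right_estimate:
  assumes "valid \<sigma>"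
  shows "mass \<sigma> / scale \<sigma> * (1 - pos \<sigma>) \<le> 2 * ((1 - val \<sigma>) / scale \<sigma>) powr s"
proof -
  obtain n where "contraction ((step ^^ n) \<sigma>) = bound (den ((step ^^ n) \<sigma>))"
    using exists_contraction[OF assms] by blast
  then have "3 \<le> digit ((step ^^ n) \<sigma>)"
    using digit_bounds(1)[OF valid_funpow[OF assms, of n]] by (simp add: bound_def)
  then show ?thesis by (rule right_estimate_if_later_digit_ge_3[OF assms])
qed

section \<open>Separation of two points at their first different digit\<close>

text \<open>\<open>pos\<close> is left out: contractions depend only on the other components, so two
  points go through the same stages as long as their digits agree.\<close>

definition same_node :: "state \<Rightarrow> state \<Rightarrow> bool" where
  "same_node \<sigma> \<tau> \<longleftrightarrow> den \<sigma> = den \<tau> \<and> scale \<sigma> = scale \<tau> \<and> mass \<sigma> = mass \<tau>"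

lemma same_node_contraction: "same_node \<sigma> \<tau> \<Longrightarrow> contraction \<sigma> = contraction \<tau>"
  by (simp add: same_node_def contraction_def)

lemma same_node_step:
  "same_node \<sigma> \<tau> \<Longrightarrow> digit \<sigma> = digit \<tau> \<Longrightarrow> same_node (step \<sigma>) (step \<tau>)"
  using same_node_contraction[of \<sigma> \<tau>] by (simp add: same_node_def)

text \<open>Both points refer to the same left endpoint of the child, so it cancels when the
  identities of \<open>step_left\<close> are subtracted.\<close>

lemma same_digit_step_diff:
  assumes v: "valid \<sigma>" "valid \<tau>" and same: "same_node \<sigma> \<tau>" and d: "digit \<sigma> = digit \<tau>"
  shows "mass (step \<sigma>) / scale (step \<sigma>) * (pos (step \<tau>) - pos (step \<sigma>)) =
      mass \<sigma> / scale \<sigma> * (pos \<tau> - pos \<sigma>)"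
    and "(val (step \<tau>) - val (step \<sigma>)) / scale (step \<sigma>) = (val \<tau> - val \<sigma>) / scale \<sigma>"
proof -
  have nodes: "mass \<tau> = mass \<sigma>" "scale \<tau> = scale \<sigma>" "contraction \<tau> = contraction \<sigma>"
    "mass (step \<tau>) = mass (step \<sigma>)" "scale (step \<tau>) = scale (step \<sigma>)"
    using same same_node_step[OF same d] same_node_contraction[OF same] by (auto simp: same_node_def)
  have m: "real (contraction \<sigma>) \<noteq> 0" using contraction_ge_1[of \<sigma>] by auto
  have "mass (step \<sigma>) / scale (step \<sigma>) * (pos (step \<tau>) - pos (step \<sigma>)) =
      mass (step \<tau>) / scale (step \<tau>) * pos (step \<tau>) - mass (step \<sigma>) / scale (step \<sigma>) * pos (step \<sigma>)"
    unfolding nodes by (simp only: right_diff_distrib)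
  also have "\<dots> = mass \<sigma> / scale \<sigma> * (pos \<tau> - pos \<sigma>)"
    unfolding step_left(1)[OF v(1)] step_left(1)[OF v(2)] unfolding nodes d[symmetric]
    using m by (simp add: right_diff_distrib)
  finally show "mass (step \<sigma>) / scale (step \<sigma>) * (pos (step \<tau>) - pos (step \<sigma>)) =
      mass \<sigma> / scale \<sigma> * (pos \<tau> - pos \<sigma>)" .
  have "(val (step \<tau>) - val (step \<sigma>)) / scale (step \<sigma>) =
      val (step \<tau>) / scale (step \<tau>) - val (step \<sigma>) / scale (step \<sigma>)"
    unfolding nodes by (simp only: diff_divide_distrib)
  also have "\<dots> = (val \<tau> - val \<sigma>) / scale \<sigma>"
    unfolding step_left(2)[OF v(1)] step_left(2)[OF v(2)] unfolding nodes d[symmetric]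
    by (simp add: diff_divide_distrib)
  finally show "(val (step \<tau>) - val (step \<sigma>)) / scale (step \<sigma>) = (val \<tau> - val \<sigma>) / scale \<sigma>" .
qed

text \<open>With \<open>c > c'\<close> the first digits at the node, the gap is split at the right endpoint
  \<open>1 / (c - 1)\<close> of the cylinder of \<open>c\<close> and at the left endpoint \<open>1 / c'\<close> of the cylinder of \<open>c'\<close>.\<close>

lemma expanding_if_digit_neq:
  assumes v: "valid \<sigma>" "valid \<tau>" and same: "same_node \<sigma> \<tau>" and less: "pos \<sigma> < pos \<tau>"
    and d: "digit \<sigma> \<noteq> digit \<tau>"
  shows "val \<sigma> \<le> val \<tau> \<and> mass \<sigma> / scale \<sigma> * (pos \<tau> - pos \<sigma>) \<le> 5 * ((val \<tau> - val \<sigma>) / scale \<sigma>) powr s"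
proof -
  define k where "k = mass \<sigma> / scale \<sigma>"
  define m where "m = real (contraction \<sigma>)"
  define a where "a = 1 / (real (digit \<sigma>) - 1)"
  define b where "b = 1 / real (digit \<tau>)"
  have nodes: "mass \<tau> = mass \<sigma>" "scale \<tau> = scale \<sigma>" "contraction \<tau> = contraction \<sigma>"
    using same same_node_contraction[OF same] by (auto simp: same_node_def)
  have m: "1 \<le> m" using contraction_ge_1[of \<sigma>] by (simp add: m_def)
  have sc: "1 \<le> scale \<sigma>" "0 < pos \<sigma>" using v(1) by (auto simp: valid_def)
  have "digit \<tau> \<le> digit \<sigma>"
    unfolding digit_def nodes using less sc m
    by (intro first_digit_antimono) (auto simp: m_def divide_right_mono)
  with d have "digit \<tau> + 1 \<le> digit \<sigma>" by simp
  then have dd: "real (digit \<tau>) \<le> real (digit \<sigma>) - 1" by linarith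
  have d1: "m + 1 \<le> real (digit \<tau>)" using digit_bounds(1)[OF v(2)] unfolding nodes m_def by linarith
  have ab: "a \<le> b" unfolding a_def b_def using dd d1 m by (intro divide_left_mono) auto
  have a0: "0 \<le> a" unfolding a_def using dd d1 m by auto
  have mb: "m * b \<le> 1" unfolding b_def using d1 m by simp
  have val: "val \<sigma> \<le> a" "b \<le> val \<tau>"
    using val_bounds(4)[OF v(1)] val_bounds(3)[OF v(2)] by (auto simp: a_def b_def)
  have mono: "(x / scale \<sigma>) powr s \<le> ((val \<tau> - val \<sigma>) / scale \<sigma>) powr s"
    if "0 \<le> x" "x \<le> val \<tau> - val \<sigma>" for x
    using that sc s_pos by (intro powr_mono2 divide_right_mono) auto
  have "k * (m * (a - pos \<sigma> / m)) = mass (step \<sigma>) / scale (step \<sigma>) * (1 - pos (step \<sigma>))"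
    unfolding step_right[OF v(1)] k_def m_def a_def ..
  also have "\<dots> \<le> 2 * ((1 - val (step \<sigma>)) / scale (step \<sigma>)) powr s"
    by (rule right_estimate[OF valid_step[OF v(1)]])
  also have "\<dots> = 2 * ((a - val \<sigma>) / scale \<sigma>) powr s"
    unfolding step_right[OF v(1)] a_def ..
  also have "\<dots> \<le> 2 * ((val \<tau> - val \<sigma>) / scale \<sigma>) powr s"
    using mono[of "a - val \<sigma>"] val ab by simp
  finally have 1: "k * (m * (a - pos \<sigma> / m)) \<le> 2 * ((val \<tau> - val \<sigma>) / scale \<sigma>) powr s" .
  have "m * (b - a) \<le> m * b" using a0 m by (intro mult_left_mono) auto
  then have "k * (m * (b - a)) \<le> ((b - a) / scale \<sigma>) powr s"
    unfolding k_def m_def using mb ab by (intro mass_estimate v) (auto simp: m_def)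
  also have "\<dots> \<le> ((val \<tau> - val \<sigma>) / scale \<sigma>) powr s"
    using mono[of "b - a"] val ab by simp
  finally have 2: "k * (m * (b - a)) \<le> ((val \<tau> - val \<sigma>) / scale \<sigma>) powr s" .
  have "k * (m * (pos \<tau> / m - b)) = mass (step \<tau>) / scale (step \<tau>) * pos (step \<tau>)"
    unfolding step_left[OF v(2)] k_def m_def b_def nodes ..
  also have "\<dots> \<le> 2 * (val (step \<tau>) / scale (step \<tau>)) powr s"
    by (rule left_estimate[OF valid_step[OF v(2)]])
  also have "\<dots> = 2 * ((val \<tau> - b) / scale \<sigma>) powr s"
    unfolding step_left[OF v(2)] b_def nodes ..
  also have "\<dots> \<le> 2 * ((val \<tau> - val \<sigma>) / scale \<sigma>) powr s"
    using mono[of "val \<tau> - b"] val ab by simp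
  finally have 3: "k * (m * (pos \<tau> / m - b)) \<le> 2 * ((val \<tau> - val \<sigma>) / scale \<sigma>) powr s" .
  \<comment> \<open>The constant \<open>5\<close> is \<open>2 + 1 + 2\<close>, from the right
    estimate, the middle gap and the left estimate.\<close>
  have "k * (pos \<tau> - pos \<sigma>) = k * (m * (a - pos \<sigma> / m)) + k * (m * (b - a)) + k * (m * (pos \<tau> / m - b))"
    using m by (simp add: algebra_simps)
  also have "\<dots> \<le> 5 * ((val \<tau> - val \<sigma>) / scale \<sigma>) powr s" using 1 2 3 by linarith
  finally show ?thesis using val ab unfolding k_def by linarith
qed

text \<open>While the digits agree, absolute distances of points and of images are unchanged, so the
  inequality is inherited from the first stage where the digits differ.\<close>

lemma expanding_if_later_digit_neq:
  assumes "valid \<sigma>" "valid \<tau>" "same_node \<sigma> \<tau>" "pos \<sigma> < pos \<tau>"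
    and "digit ((step ^^ n) \<sigma>) \<noteq> digit ((step ^^ n) \<tau>)"
  shows "val \<sigma> \<le> val \<tau> \<and> mass \<sigma> / scale \<sigma> * (pos \<tau> - pos \<sigma>) \<le> 5 * ((val \<tau> - val \<sigma>) / scale \<sigma>) powr s"
  using assms
proof (induction n arbitrary: \<sigma> \<tau>)
  case 0
  then show ?case by (intro expanding_if_digit_neq) auto
next
  case (Suc n)
  note v = Suc.prems(1,2) and same = Suc.prems(3) and less = Suc.prems(4)
  show ?case
  proof (cases "digit \<sigma> = digit \<tau>")
    case True
    have sc: "0 < scale \<sigma>" "0 < mass \<sigma>" "0 < scale (step \<sigma>)" "0 < mass (step \<sigma>)"
      using v(1) valid_step[OF v(1)] unfolding valid_def by linarith+
    have "0 < mass \<sigma> / scale \<sigma> * (pos \<tau> - pos \<sigma>)" using sc less by simp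
    then have "0 < mass (step \<sigma>) / scale (step \<sigma>) * (pos (step \<tau>) - pos (step \<sigma>))"
      by (simp only: same_digit_step_diff(1)[OF v same True])
    then have "0 < pos (step \<tau>) - pos (step \<sigma>)"
      using sc by (simp only: zero_less_mult_iff) (auto dest: divide_neg_pos simp del: step_simps)
    then have *: "val (step \<sigma>) \<le> val (step \<tau>) \<and> mass (step \<sigma>) / scale (step \<sigma>) * (pos (step \<tau>) - pos (step \<sigma>))
        \<le> 5 * ((val (step \<tau>) - val (step \<sigma>)) / scale (step \<sigma>)) powr s"
      using Suc.prems(5) by (intro Suc.IH valid_step v same_node_step same True)
        (auto simp: funpow_swap1 simp del: step_simps)
    then have "0 \<le> (val (step \<tau>) - val (step \<sigma>)) / scale (step \<sigma>)"
      using sc by (simp del: step_simps)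
    then have "val \<sigma> \<le> val \<tau>"
      using sc unfolding same_digit_step_diff(2)[OF v same True] by (simp add: zero_le_divide_iff)
    with * show ?thesis
      unfolding same_digit_step_diff[OF v same True] by simp
  qed (use Suc.prems in \<open>intro expanding_if_digit_neq\<close>)
qed

text \<open>Otherwise both points stay in common intervals of length \<open>mass / scale\<close>,
  which is at most \<open>(2 ^ n) powr -s\<close> after \<open>n\<close> steps and tends to
  \<open>0\<close>, while their distance is fixed.\<close>

lemma exists_digit_neq:
  assumes "valid \<sigma>" "valid \<tau>" "same_node \<sigma> \<tau>" "pos \<sigma> < pos \<tau>"
  shows "\<exists>n. digit ((step ^^ n) \<sigma>) \<noteq> digit ((step ^^ n) \<tau>)"
proof (rule ccontr)
  assume "\<not> ?thesis"
  then have d: "digit ((step ^^ n) \<sigma>) = digit ((step ^^ n) \<tau>)" for n by blast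
  note vs = valid_funpow[OF assms(1)] valid_funpow[OF assms(2)]
  have same: "same_node ((step ^^ n) \<sigma>) ((step ^^ n) \<tau>)" for n
    by (induction n) (use assms(3) d same_node_step in auto)
  define gap where "gap = mass \<sigma> / scale \<sigma> * (pos \<tau> - pos \<sigma>)"
  have eq: "mass ((step ^^ n) \<sigma>) / scale ((step ^^ n) \<sigma>) * (pos ((step ^^ n) \<tau>) - pos ((step ^^ n) \<sigma>)) = gap" for n
  proof (induction n)
    case (Suc n)
    then show ?case
      using same_digit_step_diff(1)[OF vs same d, of n] by (simp del: step_simps)
  qed (simp add: gap_def)
  have sc: "1 \<le> scale \<sigma>" "1 \<le> mass \<sigma>" using assms(1) by (auto simp: valid_def)
  have le: "gap \<le> ((1/2) powr s) ^ n" for n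
  proof -
    define \<sigma>' \<tau>' where "\<sigma>' = (step ^^ n) \<sigma>" and "\<tau>' = (step ^^ n) \<tau>"
    have v: "1 \<le> scale \<sigma>'" "1 \<le> mass \<sigma>'" "mass \<sigma>' \<le> scale \<sigma>' powr (1 - s)" "0 < pos \<sigma>'" "pos \<tau>' \<le> 1"
      using vs[of n] by (auto simp: \<sigma>'_def \<tau>'_def valid_def)
    have "gap \<le> mass \<sigma>' / scale \<sigma>' * 1"
      unfolding eq[of n, symmetric] \<sigma>'_def[symmetric] \<tau>'_def[symmetric] using v by (intro mult_left_mono) auto
    also have "\<dots> \<le> scale \<sigma>' powr (1 - s) / scale \<sigma>'" using v by (simp add: divide_right_mono)
    also have "\<dots> = scale \<sigma>' powr -s" using v by (simp add: powr_diff powr_minus field_simps)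
    also have "\<dots> \<le> (2 ^ n) powr -s"
      using scale_funpow_ge[OF assms(1), of n] s_pos unfolding \<sigma>'_def by (intro powr_mono2') auto
    also have "\<dots> = ((1/2) powr s) ^ n"
      by (simp add: powr_realpow[symmetric] powr_powr powr_minus powr_divide power_divide mult.commute field_simps)
    finally show ?thesis .
  qed
  have "(\<lambda>n. ((1/2) powr s) ^ n) \<longlonglongrightarrow> (0::real)"
    using powr_less_mono'[of "1/2::real" 0 s] s_pos by (intro LIMSEQ_power_zero) auto
  then have "gap \<le> 0" using le by (intro LIMSEQ_le_const) auto
  moreover have "0 < gap" unfolding gap_def using sc assms(4) by simp
  ultimately show False by simp
qed

text \<open>No digit has been written yet; \<open>den = 0\<close> lies below \<open>q0\<close>, so
  the first stage cannot be exceptional.\<close>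

definition root :: "real \<Rightarrow> state" where
  "root x = State x 0 1 1"

lemma valid_root: "x \<in> {0<..1} \<Longrightarrow> valid (root x)"
  by (simp add: valid_def root_def)

text \<open>At the root \<open>mass = scale = 1\<close>, so the estimate becomes the hypothesis of
  \<open>hausdorff_measure_pos_of_expanding\<close> with \<open>C = 5\<close>.\<close>

lemma val_root_expanding:
  assumes "x \<in> {0<..1}" "y \<in> {0<..1}"
  shows "\<bar>x - y\<bar> \<le> 5 * dist (val (root x)) (val (root y)) powr s"
proof -
  have less: "\<bar>x - y\<bar> \<le> 5 * dist (val (root x)) (val (root y)) powr s"
    if xy: "x \<in> {0<..1}" "y \<in> {0<..1}" "x < y" for x y
  proof -
    have *: "valid (root x)" "valid (root y)" "same_node (root x) (root y)" "pos (root x) < pos (root y)"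
      using xy valid_root by (auto simp: same_node_def root_def)
    obtain n where "digit ((step ^^ n) (root x)) \<noteq> digit ((step ^^ n) (root y))"
      using exists_digit_neq[OF *] by blast
    from expanding_if_later_digit_neq[OF * this] show ?thesis
      using xy by (auto simp: root_def dist_real_def abs_if)
  qed
  show ?thesis
    using less[OF assms] less[OF assms(2,1)] by (cases x y rule: linorder_cases) (auto simp: dist_commute abs_minus_commute)
qed

section \<open>Infinitely many good approximations of the image points\<close>

context
  fixes x :: real
  assumes x: "x \<in> {0<..1}"
begin

lemma den_funpow_root:
  "scale ((step ^^ n) (root x)) = real (\<Prod>j=1..<Suc n. digits (root x) j * (digits (root x) j - 1))"
  "den ((step ^^ Suc n) (root x)) = real (lueroth_denom (digits (root x)) (Suc n))"
proof -
  show *: "scale ((step ^^ n) (root x)) = real (\<Prod>j=1..<Suc n. digits (root x) j * (digits (root x) j - 1))" for n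
  proof (induction n)
    case (Suc n)
    have "1 \<le> digit ((step ^^ n) (root x))"
      using digit_bounds(2)[OF valid_funpow[OF valid_root[OF x]], of n] by linarith
    then show ?case using Suc by (simp add: digits_def of_nat_diff mult_ac)
  qed (simp add: root_def)
  show "den ((step ^^ Suc n) (root x)) = real (lueroth_denom (digits (root x)) (Suc n))"
    using *[of n] by (simp add: lueroth_denom_def digits_def)
qed

text \<open>The remainder of the series is the tail value scaled into its cylinder;
  \<open>step_left\<close> peels off one term at a time.\<close>

lemma val_funpow_root:
  "val (root x) - (\<Sum>k<n. 1 / real (lueroth_denom (digits (root x)) (Suc k))) =
     val ((step ^^ n) (root x)) / scale ((step ^^ n) (root x))"
proof (induction n)
  case (Suc n)
  define \<sigma> where "\<sigma> = (step ^^ n) (root x)"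
  have v: "valid \<sigma>" unfolding \<sigma>_def by (intro valid_funpow valid_root x)
  have "real (lueroth_denom (digits (root x)) (Suc n)) = real (digit \<sigma>) * scale \<sigma>"
    unfolding den_funpow_root(2)[symmetric] by (simp add: \<sigma>_def)
  then have "val (root x) - (\<Sum>k<Suc n. 1 / real (lueroth_denom (digits (root x)) (Suc k))) =
      val \<sigma> / scale \<sigma> - 1 / (real (digit \<sigma>) * scale \<sigma>)"
    using Suc unfolding \<sigma>_def[symmetric] by simp
  also have "\<dots> = val (step \<sigma>) / scale (step \<sigma>)"
    unfolding step_left(2)[OF v] by (simp add: diff_divide_distrib)
  finally show ?case by (simp add: \<sigma>_def del: step_simps)
qed (simp add: root_def)

lemma infinitely_many_contractions:
  "\<exists>n\<ge>N. real q0 \<le> den ((step ^^ n) (root x)) \<and>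
     contraction ((step ^^ n) (root x)) = bound (den ((step ^^ n) (root x)))"
proof -
  obtain n where "real q0 \<le> den ((step ^^ n) ((step ^^ N) (root x))) \<and>
     contraction ((step ^^ n) ((step ^^ N) (root x))) = bound (den ((step ^^ n) ((step ^^ N) (root x))))"
    using exists_contraction[OF valid_funpow[OF valid_root[OF x], of N]] by blast
  then have "real q0 \<le> den ((step ^^ (n + N)) (root x)) \<and>
     contraction ((step ^^ (n + N)) (root x)) = bound (den ((step ^^ (n + N)) (root x)))"
    by (simp add: funpow_add)
  then show ?thesis by (intro exI[of _ "n + N"]) simp
qed

text \<open>At an exceptional stage with \<open>q = Q\<^sub>n\<close> the next digit exceeds
  \<open>bound q\<close>, so \<open>val\<close> is below \<open>q powr -t\<close>; the remainder
  \<open>val / scale\<close> is then below \<open>\<psi> q / q\<close> because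
  \<open>scale \<ge> q\<close>.\<close>

lemma val_root_in_limsup_set:
  assumes \<psi>: "\<And>q. q0 \<le> q \<Longrightarrow> real q powr -t \<le> \<psi> q"
  shows "val (root x) \<in> lueroth_limsup_set \<psi>"
proof -
  note v = valid_root[OF x]
  note exp = is_lueroth_expansion_val[OF v]
  have dig: "lueroth_digit (val (root x)) = digits (root x)" by (rule lueroth_digit_eq[OF exp])
  have "\<exists>n\<ge>N. \<bar>val (root x) - lueroth_P n (val (root x)) / real (lueroth_Q n (val (root x)))\<bar>
      < \<psi> (lueroth_Q n (val (root x))) / real (lueroth_Q n (val (root x)))" for N
  proof -
    obtain n where n: "N \<le> n" "real q0 \<le> den ((step ^^ n) (root x))"
      "contraction ((step ^^ n) (root x)) = bound (den ((step ^^ n) (root x)))"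
      using infinitely_many_contractions by blast
    then obtain l where l: "n = Suc l" using q0 by (cases n) (auto simp: root_def)
    define \<sigma> where "\<sigma> = (step ^^ n) (root x)"
    define q where "q = lueroth_Q n (val (root x))"
    have v\<sigma>: "valid \<sigma>" unfolding \<sigma>_def by (intro valid_funpow v)
    have q: "den \<sigma> = real q"
      unfolding \<sigma>_def q_def l den_funpow_root(2) lueroth_Q_def dig ..
    then have "q0 \<le> q" "0 < q" using n(2) q0 unfolding \<sigma>_def by auto
    have qs: "real q \<le> scale \<sigma>"
      unfolding q[symmetric] unfolding \<sigma>_def l
      using scale_step_ge(2)[OF valid_funpow[OF v, of l]] by simp
    have "lueroth_P n (val (root x)) / real q = (\<Sum>k<n. 1 / real (lueroth_denom (digits (root x)) (Suc k)))"
      unfolding lueroth_P_def q_def[symmetric] dig using \<open>0 < q\<close> by (simp add: sum.atLeast1_atMost_eq)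
    then have "val (root x) - lueroth_P n (val (root x)) / real q = val \<sigma> / scale \<sigma>"
      unfolding \<sigma>_def val_funpow_root[symmetric] by simp
    moreover have "0 < val \<sigma> / scale \<sigma>" using val_bounds(1)[OF v\<sigma>] qs \<open>0 < q\<close> by simp
    moreover have "val \<sigma> / scale \<sigma> < \<psi> q / real q"
    proof -
      have c: "real (bound (real q)) \<le> real (digit \<sigma>) - 1"
        using digit_bounds(1)[OF v\<sigma>] n(3) q unfolding \<sigma>_def by simp
      have pow: "0 < real q powr t" using \<open>0 < q\<close> by simp
      have "val \<sigma> \<le> 1 / (real (digit \<sigma>) - 1)" by (rule val_bounds(4)[OF v\<sigma>])
      also have "\<dots> \<le> 1 / real (bound (real q))"
        using c bound_gt[of "real q"] pow by (intro frac_le) linarith+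
      also have "\<dots> < 1 / real q powr t"
        using bound_gt[of "real q"] pow by (intro divide_strict_left_mono mult_pos_pos) linarith+
      also have "\<dots> = real q powr -t" by (simp add: powr_minus_divide)
      also have "\<dots> \<le> \<psi> q" by (rule \<psi>[OF \<open>q0 \<le> q\<close>])
      finally have "val \<sigma> < \<psi> q" .
      moreover have "val \<sigma> / scale \<sigma> \<le> val \<sigma> / real q"
        using val_bounds(1)[OF v\<sigma>] qs \<open>0 < q\<close> by (intro divide_left_mono) auto
      ultimately show ?thesis
        using \<open>0 < q\<close> divide_strict_right_mono[of "val \<sigma>" "\<psi> q" "real q"] by linarith
    qed
    ultimately have "\<bar>val (root x) - lueroth_P n (val (root x)) / real q\<bar> < \<psi> q / real q" by simp
    then show ?thesis using n(1) unfolding q_def by blast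
  qed
  then show ?thesis
    using val_bounds[OF v] by (auto simp: lueroth_limsup_set_def frequently_sequentially)
qed

end

end

lemma hausdorff_measure_lueroth_limsup_set_neq_0:
  fixes s t :: real
  assumes t: "0 \<le> t" and s: "0 \<le> s" "s < 1 / (1 + t)"
    and \<psi>: "\<forall>\<^sub>F q in sequentially. real q powr -t \<le> \<psi> q"
  shows "hausdorff_measure s (lueroth_limsup_set \<psi>) \<noteq> 0"
proof -
  obtain q0 where q0_props: "1 \<le> q0" "\<And>q. q0 \<le> q \<Longrightarrow> real q powr -t \<le> \<psi> q"
    using \<psi> unfolding eventually_sequentially by (metis le_trans linear)
  \<comment> \<open>For \<open>s = 0\<close> an auxiliary positive exponent drives the construction,
    which then only shows that the limsup set is nonempty.\<close>
  define s' where "s' = (if s = 0 then 1 / (2 + t) else s)"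
  have "1 / (2 + t) < 1 / (1 + t)" using t by (intro divide_strict_left_mono) auto
  then have s': "0 < s'" "s' < 1 / (1 + t)" using s t by (auto simp: s'_def)
  interpret sparse_lueroth s' t q0
    using s' t q0_props by unfold_locales (auto simp: field_simps)
  have sub: "(\<lambda>x. val (root x)) ` {0<..1} \<subseteq> lueroth_limsup_set \<psi>"
    by (auto intro!: val_root_in_limsup_set q0_props(2))
  show ?thesis
  proof (cases "s = 0")
    case True
    have "lueroth_limsup_set \<psi> \<noteq> {}" using sub by auto
    then show ?thesis using True hausdorff_measure_0_eq_0D by blast
  next
    case False
    then have "s' = s" by (simp add: s'_def)
    then show ?thesis
      using hausdorff_measure_pos_of_expanding[OF s'(1) _ sub val_root_expanding] by simp
  qed
qed

section \<open>The dimension bounds\<close>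

lemma eventually_order_bounds:
  fixes \<psi> :: "nat \<Rightarrow> real"
  assumes "\<And>q. 1 \<le> q \<Longrightarrow> 0 < \<psi> q"
  shows "ereal t < lower_order \<psi> \<Longrightarrow> \<forall>\<^sub>F q in sequentially. \<psi> q \<le> real q powr -t"
    and "upper_order \<psi> < ereal t \<Longrightarrow> \<forall>\<^sub>F q in sequentially. real q powr -t \<le> \<psi> q"
proof -
  \<comment> \<open>From \<open>q = 2\<close> on \<open>ln q\<close> is positive, so the bounds on
    the quotient can be cleared of the denominator and exponentiated.\<close>
  have powr: "real q powr -t = exp (- (t * ln (real q)))" "\<psi> q = exp (ln (\<psi> q))" "0 < ln (real q)"
    if "2 \<le> q" for q
    using that assms[of q] by (auto simp: powr_def)
  show "\<forall>\<^sub>F q in sequentially. \<psi> q \<le> real q powr -t" if "ereal t < lower_order \<psi>"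
  proof -
    have "\<forall>\<^sub>F q in sequentially. ereal t < ereal (- ln (\<psi> q) / ln (real q))"
      using that unfolding lower_order_def by (rule less_LiminfD)
    then show ?thesis
      using eventually_ge_at_top[of 2]
    proof eventually_elim
      case (elim q)
      then have "t * ln (real q) < - ln (\<psi> q)" using powr(3)[of q] by (simp add: field_simps)
      then have "exp (ln (\<psi> q)) \<le> exp (- (t * ln (real q)))" by simp
      then show ?case using powr[of q] elim by argo
    qed
  qed
  show "\<forall>\<^sub>F q in sequentially. real q powr -t \<le> \<psi> q" if "upper_order \<psi> < ereal t"
  proof -
    have "\<forall>\<^sub>F q in sequentially. ereal (- ln (\<psi> q) / ln (real q)) < ereal t"
      using that unfolding upper_order_def by (rule Limsup_lessD)
    then show ?thesis
      using eventually_ge_at_top[of 2]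
    proof eventually_elim
      case (elim q)
      then have "- ln (\<psi> q) < t * ln (real q)" using powr(3)[of q] by (simp add: field_simps)
      then have "exp (- (t * ln (real q))) \<le> exp (ln (\<psi> q))" by simp
      then show ?case using powr[of q] elim by argo
    qed
  qed
qed

lemma lower_order_nonneg:
  assumes "\<And>q. 1 \<le> q \<Longrightarrow> 0 < \<psi> q \<and> \<psi> q \<le> 1"
  shows "0 \<le> lower_order \<psi>"
  unfolding lower_order_def
proof (rule Liminf_bounded)
  show "\<forall>\<^sub>F q in sequentially. 0 \<le> ereal (- ln (\<psi> q) / ln (real q))"
    using eventually_ge_at_top[of 1]
  proof eventually_elim
    case (elim q)
    have "0 \<le> - ln (\<psi> q)" using assms[OF elim] by simp
    moreover have "0 \<le> ln (real q)" using elim by simp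
    ultimately show ?case by (simp only: ereal_less_eq divide_nonneg_nonneg flip: zero_ereal_def)
  qed
qed

lemma lower_order_le_upper_order: "lower_order \<psi> \<le> upper_order \<psi>"
  unfolding lower_order_def upper_order_def by (rule Liminf_le_Limsup) simp

lemma hausdorff_dim_le:
  "0 \<le> s \<Longrightarrow> hausdorff_measure s A = 0 \<Longrightarrow> hausdorff_dim A \<le> ereal s"
  unfolding hausdorff_dim_def by (intro INF_lower) auto

lemma hausdorff_dim_nonneg: "0 \<le> hausdorff_dim A"
  unfolding hausdorff_dim_def by (intro INF_greatest) auto

theorem theorem3:
  fixes \<psi> :: "nat \<Rightarrow> real"
  assumes "\<And>q. 1 \<le> q \<Longrightarrow> 0 < \<psi> q \<and> \<psi> q \<le> 1"
  shows "1 / (1 + upper_order \<psi>) \<le> hausdorff_dim (lueroth_limsup_set \<psi>) \<and>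
         hausdorff_dim (lueroth_limsup_set \<psi>) \<le> 1 / (1 + lower_order \<psi>)"
proof
  have pos: "\<And>q. 1 \<le> q \<Longrightarrow> 0 < \<psi> q" using assms by blast
  have lower: "0 \<le> lower_order \<psi>" by (rule lower_order_nonneg[OF assms])
  then have upper: "0 \<le> upper_order \<psi>" using lower_order_le_upper_order order_trans by blast
  show "1 / (1 + upper_order \<psi>) \<le> hausdorff_dim (lueroth_limsup_set \<psi>)"
  proof (cases "upper_order \<psi>")
    case (real u)
    show ?thesis
    proof (rule ccontr)
      assume "\<not> ?thesis"
      then obtain s where s: "0 \<le> s" "hausdorff_measure s (lueroth_limsup_set \<psi>) = 0"
        and "ereal s < 1 / (1 + upper_order \<psi>)"
        unfolding not_le hausdorff_dim_def INF_less_iff by auto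
      then have su: "s < 1 / (1 + u)" and u: "0 \<le> u"
        using upper by (auto simp: real one_ereal_def)
      \<comment> \<open>For \<open>s > 0\<close> the second condition reads
        \<open>t < 1 / s - 1\<close>, which leaves room above \<open>u\<close>; for
        \<open>s = 0\<close> any \<open>t > u\<close> works.\<close>
      obtain t where t: "u < t" "s < 1 / (1 + t)"
      proof (cases "s = 0")
        case True
        then show ?thesis using that[of "u + 1"] u by simp
      next
        case False
        then have "u < 1 / s - 1" using su s(1) u by (simp add: field_simps)
        then obtain t where "u < t" "t < 1 / s - 1" using dense by blast
        then show ?thesis using that[of t] False s(1) u by (simp add: field_simps)
      qed
      then have "\<forall>\<^sub>F q in sequentially. real q powr -t \<le> \<psi> q"
        using real by (intro eventually_order_bounds(2) pos) auto
      then show False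
        using hausdorff_measure_lueroth_limsup_set_neq_0[of t s \<psi>] s t u by simp
    qed
  \<comment> \<open>An infinite upper order turns the left side into \<open>0\<close>.\<close>
  qed (use upper hausdorff_dim_nonneg in auto)
  show "hausdorff_dim (lueroth_limsup_set \<psi>) \<le> 1 / (1 + lower_order \<psi>)"
  proof (rule ccontr)
    assume "\<not> ?thesis"
    then obtain s where s: "1 / (1 + lower_order \<psi>) < ereal s"
      "ereal s < hausdorff_dim (lueroth_limsup_set \<psi>)"
      using ereal_dense2 unfolding not_le by blast
    have "0 \<le> 1 / (1 + lower_order \<psi>)" using lower by (cases "lower_order \<psi>") (auto simp: one_ereal_def)
    then have s0: "0 < s" using s(1) by (metis ereal_less(2) le_less_trans)
    \<comment> \<open>For \<open>s > 1\<close> the choice \<open>t = 0\<close> works because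
      \<open>\<psi> \<le> 1\<close>. Otherwise \<open>1 / s - 1\<close> is nonnegative, and
      \<open>t\<close> is taken between it and the lower order.\<close>
    have "\<exists>t\<ge>0. 1 / (1 + t) < s \<and> (\<forall>\<^sub>F q in sequentially. \<psi> q \<le> real q powr -t)"
    proof (cases "1 < s")
      case True
      have "\<forall>\<^sub>F q in sequentially. \<psi> q \<le> real q powr -0"
        using eventually_ge_at_top[of 1] by eventually_elim (use assms in simp)
      then show ?thesis using True by (intro exI[of _ 0]) simp
    next
      case False
      have "ereal (1 / s - 1) < lower_order \<psi>"
      proof (cases "lower_order \<psi>")
        case (real r)
        then have "1 / (1 + r) < s" "0 \<le> r" using s lower by (auto simp: one_ereal_def)
        then show ?thesis using s0 by (simp add: real field_simps)
      qed (use lower in auto)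
      then obtain t where t: "ereal (1 / s - 1) < ereal t" "ereal t < lower_order \<psi>"
        using ereal_dense2 by blast
      have "0 \<le> 1 / s - 1" using False s0 by simp
      then have "0 \<le> t" using t by simp
      moreover have "1 / (1 + t) < s" using t s0 \<open>0 \<le> t\<close> by (simp add: field_simps)
      ultimately show ?thesis using eventually_order_bounds(1)[OF pos t(2)] by blast
    qed
    then have "hausdorff_measure s (lueroth_limsup_set \<psi>) = 0"
      using hausdorff_measure_lueroth_limsup_set_eq_0 by blast
    then have "hausdorff_dim (lueroth_limsup_set \<psi>) \<le> ereal s"
      using s0 by (intro hausdorff_dim_le) auto
    then show False using s(2) by simp
  qed
qed

end
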